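(* Assume the setting described in the context, fix $\varepsilon,\delta>0$, and assume that $f_0$ is coercive or $Z_{\rm ad}$ is bounded. Let $(z^\star,\gamma^\star,t^\star,\mathbf t^\star)\in Z_{\rm ad}\times\mathbb R\times(T_\varepsilon\cap(P-\rho_\varepsilon))\times\mathbf T_\varepsilon$ be a minimizer of $\Phi_\varepsilon^\delta$ over $Z_{\rm ad}\times\mathbb R\times T\times\mathbf T$. Put $\omega^\star:=\eta_\varepsilon+\mathbf t^\star$, $u^\star:=s(\omega^\star,z^\star)\in L^p(\Xi;U)$, $J^\star:=g\circ u^\star-\gamma^\star$. Then: (1) for all $z\in Z_{\rm ad}$, $$\mathbf Df_0(z^\star)[z-z^\star]+\kappa\int_{\Xi_\varepsilon}(\rho_\varepsilon+t^\star)\,A_\delta(J^\star)\;\mathbf Dg(u^\star)\big[\mathbf D_zs(\omega^\star,z^\star)[z-z^\star]\big]\,d\mu\ \ge 0;$$ (2) $$\int_{\Xi_\varepsilon}(\rho_\varepsilon+t^\star)\,A_\delta(J^\star)\,d\mu=\frac1\kappa;$$ (3) for all $t\in T_\varepsilon\cap(P-\rho_\varepsilon)$, $$\theta_\varepsilon\,\mathbf D_t\mathcal H(t^\star,\mathbf t^\star)[t-t^\star]+\kappa\int_{\Xi_\varepsilon}(J^\star)_{+,\delta}\,(t-t^\star)\,d\mu\ \ge0;$$ (4) for all $\mathbf t\in\mathbf T_\varepsilon$, $$\theta_\varepsilon\,\mathbf D_{\mathbf t}\mathcal H(t^\star,\mathbf t^\star)[\mathbf t-\mathbf t^\star]+\kappa\int_{\Xi_\varepsilon}(\rho_\varepsilon+t^\star)\,A_\delta(J^\star)\;\mathbf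 Dg(u^\star)\big[\mathbf D_{\mathbf t}s(\omega^\star,z^\star)[\mathbf t-\mathbf t^\star]\big]\,d\mu\ \ge0.$$
   Context: Setting. $Z$ is a reflexive Banach space, $U$ a Banach space, $(\Xi,\mathcal A,\mathbb P)$ a probability space whose sample space $\Xi$ is a vector space with norm $\|\cdot\|_\Xi$, and $Z_{\rm ad}\subset Z$ is nonempty, closed and convex. $f_0:Z\to\overline{\mathbb R}$, $g:U\to\overline{\mathbb R}$, $s:\Xi\times Z\to U$ satisfy: $s(\cdot,z)$ is $\mathcal A$-measurable for every $z\in Z$; if $\xi_\varepsilon\to\xi$ in $\Xi$ and $z_\varepsilon\rightharpoonup z$ in $Z$ then $s(\xi_\varepsilon,z_\varepsilon)\rightharpoonup s(\xi,z)$ in $U$; $f_0$ is proper; $f_0$ and $g$ are sequentially weakly lower semicontinuous. $\kappa=(1-\beta)^{-1}$ for some $\beta\in(0,1)$. Measure. $\mu$ is a $\sigma$-finite measure on $(\Xi,\mathcal A)$ with $\mathbb P\ll\mu$; all $L^p$ spaces on $\Xi$ refer to $\mu$. $q,q'\in(1,\infty)$, $1/q+1/q'=1$; $T:=L^q(\Xi)$, $\mathbf T:=L^{q'}(\Xi;\Xi)$. Smoothing. $\zeta:\mathbb R\to\mathbb R$ is continuous, bounded, nonnegative, $\int\zeta=1$, $\int\zeta(x)|x|dx<\infty$, either $\int_{\mathbb R}\zeta(x)x\,dx\le0$ or $\int_{-\infty}^0\zeta(x)|x|dx=0$, and $\{\zeta>0\}$ is connected. $A_\delta(\tau)=\int_{-\infty}^\tau\frac1\delta\zeta(\sigma/\delta)d\sigma$,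 $(x)_{+,\delta}=\int_{-\infty}^xA_\delta(\tau)d\tau$. Subdomains. $\{\widetilde\Xi_\varepsilon\}_{\varepsilon>0}$ are measurable subsets of $\Xi$ with $\chi_{\widetilde\Xi_\varepsilon}\to1$ a.e. as $\varepsilon\downarrow0$; $\{C_n\}_n$ is an increasing countable measurable cover of $\Xi$ with $\mu(C_n)<\infty$; $\Xi_\varepsilon:=\widetilde\Xi_\varepsilon\cap C_{\lceil1/\varepsilon\rceil}$. Corruptions. $P:=\{\varrho:\Xi\to\mathbb R_+\mid\varrho\in L^\infty(\Xi),\int_\Xi\varrho\,d\mu=1\}$; $P_\varepsilon:=\{\varrho\in P:\operatorname{supp}\varrho\subset\Xi_\varepsilon\}$; $\mathbf Q_\varepsilon:=\{\mathbf t\in L^{q'}(\Xi;\Xi):\operatorname{supp}\mathbf t\subset\Xi_\varepsilon\}$; $\rho_\varepsilon\in P_\varepsilon$, $\eta_\varepsilon\in\mathbf Q_\varepsilon$ are given. Perturbation spaces. $W_\varepsilon$, $\mathbf W_\varepsilon$ are reflexive Banach spaces of functions $\Xi_\varepsilon\to\mathbb R$, $\Xi_\varepsilon\to\Xi$, compactly embedded into $L^q(\Xi_\varepsilon)$ and $L^{q'}(\Xi_\varepsilon;\Xi)$ respectively. With $I$ the identity of $\Xi$, $T_\varepsilon:=\{t:\Xi\to\mathbb R\mid t|_{\Xi_\varepsilon}\in W_\varepsilon\oplus\operatorname{span}\{\rho_\varepsilon|_{\Xi_\varepsilon}\},\ t|_{\Xi_\varepsilon^c}\in L^q(\Xi_\varepsilon^c)\}$,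 $\mathbf T_\varepsilon:=\{\mathbf t:\Xi\to\Xi\mid\mathbf t|_{\Xi_\varepsilon}\in\mathbf W_\varepsilon\oplus\operatorname{span}\{I|_{\Xi_\varepsilon},\eta_\varepsilon|_{\Xi_\varepsilon}\},\ \mathbf t|_{\Xi_\varepsilon^c}\in L^{q'}(\Xi_\varepsilon^c;\Xi)\}$ (added elements already contained in $W_\varepsilon$, $\mathbf W_\varepsilon$ are omitted so that the sums are direct). Penalty. $\mathcal H:T\times\mathbf T\to\mathbb R$ is weakly lower semicontinuous, coercive, $\mathcal H(0,0)=0$, and $\mathcal H(t_k,\mathbf t_k)\to0$ implies $(t_k,\mathbf t_k)\to(0,0)$ strongly; $\theta_\varepsilon>0$ with $\theta_\varepsilon\to+\infty$ as $\varepsilon\to0$. Growth. There is $\varrho:[0,\infty)\to[0,\infty)$ with $|g(s(\xi,z))|\le\varrho(\|z\|_Z)\|\xi\|_\Xi$ for all $(\xi,z)$. Functional. $\Phi_\varepsilon^\delta:Z\times\mathbb R\times T\times\mathbf T\to\overline{\mathbb R}$, $$\Phi_\varepsilon^\delta(z,\gamma;t,\mathbf t)=f_0(z)+\gamma+\kappa\int_{\Xi_\varepsilon}\big(g(s(\eta_\varepsilon(\xi)+\mathbf t(\xi),z))-\gamma\big)_{+,\delta}(\rho_\varepsilon(\xi)+t(\xi))\,d\mu(\xi)+\theta_\varepsilon\mathcal H(t,\mathbf t)+\imath_{T_\varepsilon\cap(P-\rho_\varepsilon)}(t)+\imath_{\mathbf T_\varepsilon}(\mathbf t),$$ where $\imath_S=0$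 on $S$ and $+\infty$ off $S$. Differentiability assumptions. For $\mathbf t\in\mathbf T$, $s(\mathbf t,z)$ denotes $\xi\mapsto s(\mathbf t(\xi),z)$. (a) $\mathcal H$ is Fréchet differentiable, with partial derivatives $\mathbf D_t\mathcal H,\mathbf D_{\mathbf t}\mathcal H$. (b) There is $p\in[1,\infty]$ such that $s(\eta_\varepsilon+\mathbf t,z)\in L^p(\Xi;U)$ for all $\mathbf t\in\mathbf T$, $z\in Z_{\rm ad}$. (c) There is an open $V\subset Z$ with $Z_{\rm ad}\subset V$ on which $f_0$ is Fréchet differentiable, with derivative $\mathbf Df_0(z)$. (d) For each $z\in Z_{\rm ad}$, $\mathbf T\ni\mathbf t\mapsto s(\mathbf t,z)\in L^p(\Xi;U)$ is Fréchet differentiable with derivative $\mathbf D_{\mathbf t}s(\mathbf t,z)$. (e) For each $\mathbf t\in\mathbf T$, $V\ni z\mapsto s(\mathbf t,z)\in L^p(\Xi;U)$ is Fréchet differentiable with derivative $\mathbf D_zs(\mathbf t,z)$. (f) $L^p(\Xi;U)\ni u\mapsto g\circ u\in L^{q'}(\Xi)$ is Fréchet differentiable with derivative $\mathbf Dg(u)\in\mathcal L(L^p(\Xi;U),L^{q'}(\Xi))$. *)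

theory Defs
  imports "HOL-Analysis.Analysis" "HOL-Probability.Probability" "HOL-Library.Function_Algebras"
begin

section \<open>Function types as real vector spaces\<close>

instantiation "fun" :: (type, real_vector) real_vector
begin

definition scaleR_fun :: "real \<Rightarrow> ('a \<Rightarrow> 'b) \<Rightarrow> 'a \<Rightarrow> 'b"
  where "scaleR_fun c f = (\<lambda>x. c *\<^sub>R f x)"

instance
  by standard (auto simp: scaleR_fun_def fun_eq_iff scaleR_add_right scaleR_add_left)

end

section \<open>Normed spaces with explicit carrier\<close>

text \<open>
  Lebesgue spaces depend on a measure and an exponent, so they cannot be types.  A normed space is
  given by a carrier and a norm inside an ambient real vector space.  For function spaces the
  elements are representatives and \<^term>\<open>snorm\<close> is only a seminorm: two elements denote the same
  point of the space iff the seminorm of their difference is \<open>0\<close>.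
\<close>

record 'a nspace =
  pts :: "'a set"
  snorm :: "'a \<Rightarrow> real"

definition type_space :: "'a::real_normed_vector nspace"
  where "type_space = \<lparr>pts = UNIV, snorm = norm\<rparr>"

definition prod_space :: "'a nspace \<Rightarrow> 'b nspace \<Rightarrow> ('a \<times> 'b) nspace"
  where "prod_space X Y = \<lparr>pts = pts X \<times> pts Y, snorm = (\<lambda>(x, y). snorm X x + snorm Y y)\<rparr>"

definition normed_space :: "'a::real_vector nspace \<Rightarrow> bool"
  where "normed_space X \<longleftrightarrow> subspace (pts X) \<and>
    (\<forall>x\<in>pts X. 0 \<le> snorm X x) \<and>
    (\<forall>x\<in>pts X. \<forall>y\<in>pts X. snorm X (x + y) \<le> snorm X x + snorm X y) \<and>
    (\<forall>c. \<forall>x\<in>pts X. snorm X (c *\<^sub>R x) = \<bar>c\<bar> * snorm X x)"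

definition norm_tendsto :: "'a::real_vector nspace \<Rightarrow> (nat \<Rightarrow> 'a) \<Rightarrow> 'a \<Rightarrow> bool"
  where "norm_tendsto X a x \<longleftrightarrow> (\<lambda>n. snorm X (a n - x)) \<longlonglongrightarrow> 0"

definition banach_space :: "'a::real_vector nspace \<Rightarrow> bool"
  where "banach_space X \<longleftrightarrow> normed_space X \<and>
    (\<forall>a. range a \<subseteq> pts X \<and> (\<forall>e>0. \<exists>N. \<forall>m\<ge>N. \<forall>n\<ge>N. snorm X (a m - a n) < e)
       \<longrightarrow> (\<exists>x\<in>pts X. norm_tendsto X a x))"

text \<open>Linearity is required in the sense of the target space, i.e. up to elements of norm \<open>0\<close>.\<close>

definition bounded_linear_map ::
    "'a::real_vector nspace \<Rightarrow> 'b::real_vector nspace \<Rightarrow> ('a \<Rightarrow> 'b) \<Rightarrow> bool"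
  where "bounded_linear_map X Y f \<longleftrightarrow>
    (\<forall>x\<in>pts X. f x \<in> pts Y) \<and>
    (\<forall>x\<in>pts X. \<forall>y\<in>pts X. snorm Y (f (x + y) - (f x + f y)) = 0) \<and>
    (\<forall>c. \<forall>x\<in>pts X. snorm Y (f (c *\<^sub>R x) - c *\<^sub>R f x) = 0) \<and>
    (\<exists>K. \<forall>x\<in>pts X. snorm Y (f x) \<le> K * snorm X x)"

definition dual_space :: "'a::real_vector nspace \<Rightarrow> ('a \<Rightarrow> real) nspace"
  where "dual_space X =
    \<lparr>pts = {\<phi>. bounded_linear_map X type_space \<phi>},
     snorm = (\<lambda>\<phi>. Sup {\<bar>\<phi> x\<bar> |x. x \<in> pts X \<and> snorm X x \<le> 1})\<rparr>"

definition reflexive_space :: "'a::real_vector nspace \<Rightarrow> bool"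
  where "reflexive_space X \<longleftrightarrow>
    (\<forall>\<Psi>\<in>pts (dual_space (dual_space X)). \<exists>x\<in>pts X. \<forall>\<phi>\<in>pts (dual_space X). \<Psi> \<phi> = \<phi> x)"

definition weakly_tendsto :: "'a::real_vector nspace \<Rightarrow> (nat \<Rightarrow> 'a) \<Rightarrow> 'a \<Rightarrow> bool"
  where "weakly_tendsto X a x \<longleftrightarrow> (\<forall>\<phi>\<in>pts (dual_space X). (\<lambda>n. \<phi> (a n)) \<longlonglongrightarrow> \<phi> x)"

definition seq_weakly_lsc :: "'a::real_vector nspace \<Rightarrow> ('a \<Rightarrow> ereal) \<Rightarrow> bool"
  where "seq_weakly_lsc X F \<longleftrightarrow>
    (\<forall>a x. range a \<subseteq> pts X \<and> x \<in> pts X \<and> weakly_tendsto X a x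
       \<longrightarrow> F x \<le> liminf (\<lambda>n. F (a n)))"

text \<open>Lower semicontinuity for the weak topology itself, through its basic neighbourhoods.\<close>

definition weakly_lsc :: "'a::real_vector nspace \<Rightarrow> ('a \<Rightarrow> real) \<Rightarrow> bool"
  where "weakly_lsc X F \<longleftrightarrow>
    (\<forall>x\<in>pts X. \<forall>a < F x. \<exists>\<Lambda> e. finite \<Lambda> \<and> \<Lambda> \<subseteq> pts (dual_space X) \<and> 0 < e \<and>
       (\<forall>y\<in>pts X. (\<forall>\<phi>\<in>\<Lambda>. \<bar>\<phi> (y - x)\<bar> < e) \<longrightarrow> a < F y))"

definition coercive :: "'a nspace \<Rightarrow> ('a \<Rightarrow> ereal) \<Rightarrow> bool"
  where "coercive X F \<longleftrightarrow> (\<forall>c::real. \<exists>R. \<forall>x\<in>pts X. R \<le> snorm X x \<longrightarrow> ereal c \<le> F x)"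

text \<open>
  The third clause says that the embedding is injective on classes of functions.
\<close>

definition compactly_embedded :: "'a::real_vector nspace \<Rightarrow> 'a nspace \<Rightarrow> bool"
  where "compactly_embedded W X \<longleftrightarrow> pts W \<subseteq> pts X \<and>
    (\<exists>K. \<forall>w\<in>pts W. snorm X w \<le> K * snorm W w) \<and>
    (\<forall>w\<in>pts W. snorm X w = 0 \<longrightarrow> snorm W w = 0) \<and>
    (\<forall>a. range a \<subseteq> pts W \<and> (\<exists>B. \<forall>n. snorm W (a n) \<le> B)
       \<longrightarrow> (\<exists>r x. strict_mono (r :: nat \<Rightarrow> nat) \<and> x \<in> pts X \<and> norm_tendsto X (a \<circ> r) x))"

text \<open>
  Frechet derivative at \<open>x\<close> of \<open>f\<close> from \<open>D\<close> to \<open>Y\<close>, where \<open>D\<close> is an open subset of \<open>X\<close>.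
\<close>

definition has_frechet_derivative ::
    "'a::real_vector nspace \<Rightarrow> 'b::real_vector nspace \<Rightarrow> 'a set \<Rightarrow> ('a \<Rightarrow> 'b) \<Rightarrow> ('a \<Rightarrow> 'b) \<Rightarrow> 'a \<Rightarrow> bool"
  where "has_frechet_derivative X Y D f f' x \<longleftrightarrow>
    (\<forall>y\<in>D. f y \<in> pts Y) \<and> bounded_linear_map X Y f' \<and>
    (\<forall>e>0. \<exists>d>0. \<forall>h\<in>pts X. x + h \<in> D \<and> snorm X h < d
       \<longrightarrow> snorm Y (f (x + h) - f x - f' h) \<le> e * snorm X h)"

section \<open>Bochner--Lebesgue spaces\<close>

text \<open>
  Strong measurability: the library's \<^term>\<open>borel_measurable\<close> theory of Bochner integration requires
  a second countable target, which is not available for a general Banach space.  For real-valued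
  functions this is the same as Borel measurability.  It is required everywhere and not just almost
  everywhere, because the library integral of a function that is not measurable is \<open>0\<close>; every
  almost-everywhere class has such a representative.
\<close>

definition strongly_measurable :: "'a measure \<Rightarrow> ('a \<Rightarrow> 'b::real_normed_vector) \<Rightarrow> bool"
  where "strongly_measurable M f \<longleftrightarrow>
    (\<exists>a. (\<forall>n. simple_function M (a n)) \<and> (\<forall>x\<in>space M. (\<lambda>n::nat. a n x) \<longlonglongrightarrow> f x))"

definition Lp :: "'a measure \<Rightarrow> ennreal \<Rightarrow> ('a \<Rightarrow> 'b::real_normed_vector) nspace"
  where "Lp M p =
    \<lparr>pts = {f. strongly_measurable M f \<and>
       (if p = \<infinity> then \<exists>C. AE x in M. norm (f x) \<le> C
        else integrable M (\<lambda>x. norm (f x) powr enn2real p))},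
     snorm = (\<lambda>f. if p = \<infinity> then Inf {C. 0 \<le> C \<and> (AE x in M. norm (f x) \<le> C)}
        else (LINT x|M. norm (f x) powr enn2real p) powr (1 / enn2real p))\<rparr>"

section \<open>The optimization problem\<close>

definition proper :: "('a \<Rightarrow> ereal) \<Rightarrow> bool"
  where "proper F \<longleftrightarrow> (\<forall>x. F x \<noteq> -\<infinity>) \<and> (\<exists>x. F x \<noteq> \<infinity>)"

definition smoothing_kernel :: "(real \<Rightarrow> real) \<Rightarrow> bool"
  where "smoothing_kernel \<zeta> \<longleftrightarrow>
    continuous_on UNIV \<zeta> \<and> bounded (range \<zeta>) \<and> (\<forall>x. 0 \<le> \<zeta> x) \<and>
    has_bochner_integral lborel \<zeta> 1 \<and> integrable lborel (\<lambda>x. \<zeta> x * \<bar>x\<bar>) \<and>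
    ((LINT x|lborel. \<zeta> x * x) \<le> 0 \<or> (LINT x:{..0}|lborel. \<zeta> x * \<bar>x\<bar>) = 0) \<and>
    connected {x. 0 < \<zeta> x}"

definition smooth_step :: "(real \<Rightarrow> real) \<Rightarrow> real \<Rightarrow> real \<Rightarrow> real"
  where "smooth_step \<zeta> \<delta> \<tau> = (LINT \<sigma>:{..\<tau>}|lborel. 1 / \<delta> * \<zeta> (\<sigma> / \<delta>))"

definition smooth_plus :: "(real \<Rightarrow> real) \<Rightarrow> real \<Rightarrow> real \<Rightarrow> real"
  where "smooth_plus \<zeta> \<delta> x = (LINT \<tau>:{..x}|lborel. smooth_step \<zeta> \<delta> \<tau>)"

definition subdomain :: "(real \<Rightarrow> 'x set) \<Rightarrow> (nat \<Rightarrow> 'x set) \<Rightarrow> real \<Rightarrow> 'x set"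
  where "subdomain \<Xi>t C \<epsilon> = \<Xi>t \<epsilon> \<inter> C (nat \<lceil>1 / \<epsilon>\<rceil>)"

text \<open>
  As everywhere for elements of Lebesgue spaces, sign and support conditions are meant almost
  everywhere.  The condition on the integral contains integrability, since \<open>1 \<noteq> 0\<close>.
\<close>

definition densities :: "'x measure \<Rightarrow> ('x \<Rightarrow> real) set"
  where "densities M = {r. r \<in> pts (Lp M \<infinity>) \<and> (AE \<xi> in M. 0 \<le> r \<xi>) \<and> (LINT \<xi>|M. r \<xi>) = 1}"

definition supported_in :: "'x measure \<Rightarrow> 'x set \<Rightarrow> ('x \<Rightarrow> 'b::zero) \<Rightarrow> bool"
  where "supported_in M S f \<longleftrightarrow> (AE \<xi> in M. \<xi> \<notin> S \<longrightarrow> f \<xi> = 0)"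

text \<open>
  The sets \<open>T\<^sub>\<epsilon>\<close> and \<open>\<^bold>T\<^sub>\<epsilon>\<close>, for \<open>S = \<Xi>\<^sub>\<epsilon>\<close>.  Functions on \<open>S\<close> are
  represented by functions on the whole type whose values off \<open>S\<close> are ignored.  Both sets are taken
  inside the Lebesgue spaces \<open>T\<close> and \<open>\<^bold>T\<close> on which the functional is defined.  This matters
  only for \<open>\<^bold>T\<^sub>\<epsilon>\<close> and only if the identity is not in \<open>L\<^bsup>q'\<^esup>\<close> of \<open>S\<close>.
\<close>

definition pert_scalar ::
    "'x measure \<Rightarrow> real \<Rightarrow> 'x set \<Rightarrow> ('x \<Rightarrow> real) nspace \<Rightarrow> ('x \<Rightarrow> real) \<Rightarrow> ('x \<Rightarrow> real) set"
  where "pert_scalar M q S W \<rho> = {t \<in> pts (Lp M (ennreal q)).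
    (\<exists>w\<in>pts W. \<exists>a. AE \<xi> in M. \<xi> \<in> S \<longrightarrow> t \<xi> = w \<xi> + a * \<rho> \<xi>) \<and>
    t \<in> pts (Lp (restrict_space M (- S)) (ennreal q))}"

definition pert_vector ::
    "'x::real_normed_vector measure \<Rightarrow> real \<Rightarrow> 'x set \<Rightarrow> ('x \<Rightarrow> 'x) nspace \<Rightarrow> ('x \<Rightarrow> 'x) \<Rightarrow> ('x \<Rightarrow> 'x) set"
  where "pert_vector M q' S W \<eta> = {t \<in> pts (Lp M (ennreal q')).
    (\<exists>w\<in>pts W. \<exists>a b. AE \<xi> in M. \<xi> \<in> S \<longrightarrow> t \<xi> = w \<xi> + a *\<^sub>R \<xi> + b *\<^sub>R \<eta> \<xi>) \<and>
    t \<in> pts (Lp (restrict_space M (- S)) (ennreal q'))}"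

definition ext_indicator :: "'a set \<Rightarrow> 'a \<Rightarrow> ereal"
  where "ext_indicator S x = (if x \<in> S then 0 else \<infinity>)"

text \<open>
  The functional for one fixed \<open>\<epsilon>\<close>: \<open>S\<close>, \<open>\<rho>\<close>, \<open>\<eta>\<close>, \<open>\<theta>\<close> stand for the corresponding objects with
  index \<open>\<epsilon>\<close>, and \<open>A\<close>, \<open>B\<close> are the sets of admissible \<open>t\<close> and \<open>tt\<close>.  Under the growth condition
  \<open>g\<close> is finite on the range of \<open>s\<close>, so that \<^term>\<open>real_of_ereal\<close> loses nothing.
\<close>

definition Phi ::
    "'x::real_normed_vector measure \<Rightarrow> ('z \<Rightarrow> ereal) \<Rightarrow> ('u \<Rightarrow> ereal) \<Rightarrow> ('x \<Rightarrow> 'z \<Rightarrow> 'u)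
     \<Rightarrow> (('x \<Rightarrow> real) \<times> ('x \<Rightarrow> 'x) \<Rightarrow> real) \<Rightarrow> real \<Rightarrow> (real \<Rightarrow> real) \<Rightarrow> real
     \<Rightarrow> 'x set \<Rightarrow> ('x \<Rightarrow> real) \<Rightarrow> ('x \<Rightarrow> 'x) \<Rightarrow> real \<Rightarrow> ('x \<Rightarrow> real) set \<Rightarrow> ('x \<Rightarrow> 'x) set
     \<Rightarrow> 'z \<Rightarrow> real \<Rightarrow> ('x \<Rightarrow> real) \<Rightarrow> ('x \<Rightarrow> 'x) \<Rightarrow> ereal"
  where "Phi M f\<^sub>0 g s H \<kappa> \<zeta> \<delta> S \<rho> \<eta> \<theta> A B z \<gamma> t tt =
    f\<^sub>0 z + ereal \<gamma>
    + ereal (\<kappa> * (LINT \<xi>:S|M.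
        smooth_plus \<zeta> \<delta> (real_of_ereal (g (s (\<eta> \<xi> + tt \<xi>) z)) - \<gamma>) * (\<rho> \<xi> + t \<xi>)))
    + ereal (\<theta> * H (t, tt)) + ext_indicator A t + ext_indicator B tt"

end

theory Submission
  imports Defs
begin

text \<open>
  Each condition is the limit of the nonnegative difference quotients of the functional at the
  minimizer along a segment that moves one variable inside its convex constraint set, with step
  sizes \<open>r\<^sub>n = 1 / (n + 1)\<close>.  The only delicate term is the integral: by the chain rule the inner
  function has a directional derivative in \<open>L\<^bsub>q'\<^esub>\<close>, hence in \<open>L\<^bsub>1\<^esub>\<close> of the subdomain, which has
  finite measure, and the density is bounded.  So only the superposition operator of the smoothed
  plus function on \<open>L\<^bsub>1\<^esub>\<close> has to be differentiated in a fixed direction, for which its Lipschitz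
  continuity and dominated convergence suffice.
\<close>

section \<open>Lebesgue spaces\<close>

text \<open>Points of a Lebesgue space are representatives and \<open>snorm\<close> is a seminorm,
  so a derivative is additive and homogeneous only up to elements of norm 0:
  \<open>f' (r *\<^sub>R h)\<close> and \<open>r *\<^sub>R f' h\<close> need not be equal functions.
  Every such exchange is paid for by a triangle inequality, so the spaces \<open>Lp M p\<close> have
  to be shown to satisfy the seminorm axioms, Minkowski's inequality included. The four conditions
  use the difference quotients in different ways. The variables \<open>z\<close> and
  \<open>tt\<close> enter the integrand through \<open>g\<close> and \<open>s\<close> and need the
  chain rule. The variable \<open>\<gamma>\<close> shifts the integrand by a constant and is
  unconstrained, so both signs of the direction are allowed and an equation results. The density
  enters the integral affinely, so there only the penalty is differentiated.\<close>

lemma norm_strongly_measurable: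
  assumes "strongly_measurable M f"
  shows "(\<lambda>x. norm (f x)) \<in> borel_measurable M"
proof -
  obtain a where a: "\<And>n. simple_function M (a n)" "\<And>x. x \<in> space M \<Longrightarrow> (\<lambda>n. a n x) \<longlonglongrightarrow> f x"
    using assms unfolding strongly_measurable_def by blast
  show ?thesis
  proof (rule borel_measurable_LIMSEQ_real)
    show "(\<lambda>x. norm (a n x)) \<in> borel_measurable M" for n
      using simple_function_compose1[OF a(1), of norm n]
      by (rule borel_measurable_simple_function)
    show "(\<lambda>n. norm (a n x)) \<longlonglongrightarrow> norm (f x)" if "x \<in> space M" for x
      using a(2)[OF that] by (rule tendsto_norm)
  qed
qed

lemma strongly_measurable_imp_borel_measurable:
  fixes f :: "'a \<Rightarrow> real"
  assumes "strongly_measurable M f"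
  shows "f \<in> borel_measurable M"
  using assms borel_measurable_simple_function
  unfolding strongly_measurable_def by (metis borel_measurable_LIMSEQ_real)

lemma strongly_measurable_add:
  assumes "strongly_measurable M f" "strongly_measurable M g"
  shows "strongly_measurable M (f + g)"
proof -
  obtain a b where "\<And>n::nat. simple_function M (a n)" "\<And>x. x \<in> space M \<Longrightarrow> (\<lambda>n. a n x) \<longlonglongrightarrow> f x"
    and "\<And>n. simple_function M (b n)" "\<And>x. x \<in> space M \<Longrightarrow> (\<lambda>n. b n x) \<longlonglongrightarrow> g x"
    using assms unfolding strongly_measurable_def by metis
  then have "(\<forall>n. simple_function M (\<lambda>x. a n x + b n x)) \<and>
      (\<forall>x\<in>space M. (\<lambda>n. a n x + b n x) \<longlonglongrightarrow> (f + g) x)"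
    by (auto intro: tendsto_add simple_function_compose2)
  then show ?thesis
    unfolding strongly_measurable_def by (intro exI[of _ "\<lambda>n x. a n x + b n x"])
qed

lemma strongly_measurable_scaleR:
  assumes "strongly_measurable M f"
  shows "strongly_measurable M (c *\<^sub>R f)"
proof -
  obtain a where "\<And>n::nat. simple_function M (a n)" "\<And>x. x \<in> space M \<Longrightarrow> (\<lambda>n. a n x) \<longlonglongrightarrow> f x"
    using assms unfolding strongly_measurable_def by metis
  then have "(\<forall>n. simple_function M (\<lambda>x. c *\<^sub>R a n x)) \<and>
      (\<forall>x\<in>space M. (\<lambda>n. c *\<^sub>R a n x) \<longlonglongrightarrow> (c *\<^sub>R f) x)"
    by (auto simp: scaleR_fun_def intro: tendsto_scaleR simple_function_compose1)
  then show ?thesis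
    unfolding strongly_measurable_def by (intro exI[of _ "\<lambda>n x. c *\<^sub>R a n x"])
qed

lemma strongly_measurable_0: "strongly_measurable M 0"
  unfolding strongly_measurable_def by (intro exI[of _ "\<lambda>_ _. 0"]) auto

text \<open>Convexity of the power is applied only to positive arguments. If one argument is 0, the
  claim reduces to \<open>c powr p \<le> c\<close> for 0 \<le> c \<le> 1, which is what
  \<open>small\<close> rests on. This is the pointwise inequality behind Minkowski's
  inequality.\<close>

lemma powr_convex_combination:
  fixes x y a b p :: real
  assumes "0 \<le> x" "0 \<le> y" "0 \<le> a" "0 \<le> b" "a + b = 1" "1 \<le> p"
  shows "(a * x + b * y) powr p \<le> a * x powr p + b * y powr p"
proof -
  have small: "(c * w) powr p \<le> c * w powr p" if "0 \<le> c" "c \<le> 1" "0 \<le> w" for c w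
  proof -
    have "c powr p \<le> c"
      using powr_mono_both'[of 1 p c c] that assms(6) by (cases "c = 0") auto
    then show ?thesis
      using that by (auto simp: powr_mult intro: mult_right_mono)
  qed
  consider "x = 0" | "y = 0" | "0 < x" "0 < y" using assms by linarith
  then show ?thesis
  proof cases
    case 3
    moreover have "a = 1 - b" using assms(5) by simp
    ultimately show ?thesis
      using convex_onD[OF powr_convex[OF assms(6)], of b x y] assms(3,4) by simp
  qed (use small[of a x] small[of b y] assms in auto)
qed

text \<open>The infimum of the essential bounds is itself an essential bound: the bounds with slack
  1/(n+1) hold simultaneously off countably many null sets, and the slack tends to 0.\<close>

lemma Lp_infinity_snorm:
  fixes f :: "'a \<Rightarrow> 'b::real_normed_vector"
  assumes "f \<in> pts (Lp M \<infinity>)"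
  shows "0 \<le> snorm (Lp M \<infinity>) f" "AE x in M. norm (f x) \<le> snorm (Lp M \<infinity>) f"
proof -
  let ?A = "{C. 0 \<le> C \<and> (AE x in M. norm (f x) \<le> C)}"
  have s: "snorm (Lp M \<infinity>) f = Inf ?A" by (simp add: Lp_def)
  obtain C where C: "AE x in M. norm (f x) \<le> C" using assms by (auto simp: Lp_def)
  \<comment> \<open>\<open>C\<close> can be negative when the measure is zero, whereas the infimum
    ranges over nonnegative bounds only.\<close>
  then have "AE x in M. norm (f x) \<le> max 0 C" by eventually_elim simp
  then have ne: "?A \<noteq> {}" by (intro ex_in_conv[THEN iffD1] exI[of _ "max 0 C"]) simp
  have bdd: "bdd_below ?A" by (intro bdd_belowI[of _ 0]) auto
  show "0 \<le> snorm (Lp M \<infinity>) f" unfolding s by (intro cInf_greatest ne) auto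
  have "AE x in M. norm (f x) < snorm (Lp M \<infinity>) f + inverse (Suc n)" for n
  proof -
    have "Inf ?A < snorm (Lp M \<infinity>) f + inverse (Suc n)" unfolding s by simp
    then obtain c where "c \<in> ?A" "c < snorm (Lp M \<infinity>) f + inverse (Suc n)"
      using cInf_less_iff[OF ne bdd] by blast
    then show ?thesis by auto
  qed
  then have "AE x in M. \<forall>n. norm (f x) < snorm (Lp M \<infinity>) f + inverse (Suc n)"
    by (simp add: AE_all_countable)
  then show "AE x in M. norm (f x) \<le> snorm (Lp M \<infinity>) f"
  proof eventually_elim
    case (elim x)
    then show ?case
      by (intro LIMSEQ_le_const[OF LIMSEQ_inverse_real_of_nat_add]) (auto intro: less_imp_le)
  qed
qed

lemma Lp_infinity_snorm_le:
  assumes "0 \<le> C" "AE x in M. norm (f x) \<le> C"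
  shows "snorm (Lp M \<infinity>) f \<le> C"
  using assms by (auto simp: Lp_def intro!: cInf_lower bdd_belowI[of _ 0])

lemma Lp_finite:
  assumes "0 \<le> p"
  shows "pts (Lp M (ennreal p)) = {f. strongly_measurable M f \<and> integrable M (\<lambda>x. norm (f x) powr p)}"
    and "snorm (Lp M (ennreal p)) f = (LINT x|M. norm (f x) powr p) powr (1 / p)"
  using assms by (auto simp: Lp_def)

lemma Lp_snorm_nonneg:
  assumes "f \<in> pts (Lp M p)"
  shows "0 \<le> snorm (Lp M p) f"
  using Lp_infinity_snorm(1)[of f M] assms by (cases "p = \<infinity>") (auto simp: Lp_def)

lemma Lp_pts_scaleR:
  assumes "f \<in> pts (Lp M p)"
  shows "c *\<^sub>R f \<in> pts (Lp M p)"
proof (cases "p = \<infinity>")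
  case True
  with assms obtain C where "AE x in M. norm (f x) \<le> C" by (auto simp: Lp_def)
  then have "AE x in M. norm (c *\<^sub>R f x) \<le> \<bar>c\<bar> * C"
    by eventually_elim (auto intro: mult_left_mono)
  then have "\<exists>C. AE x in M. norm ((c *\<^sub>R f) x) \<le> C" unfolding scaleR_fun_def by blast
  with True assms show ?thesis
    by (simp add: Lp_def strongly_measurable_scaleR)
next
  case False
  moreover have "norm ((c *\<^sub>R f) x) powr r = \<bar>c\<bar> powr r * norm (f x) powr r" for x r
    by (simp add: scaleR_fun_def powr_mult)
  ultimately show ?thesis
    using assms by (simp add: Lp_def strongly_measurable_scaleR)
qed

text \<open>Dividing by a strict upper bound \<open>n\<close> of the norm, and not by the norm,
  avoids a division by 0 for null functions. The ball is thus described by an integral without the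
  outer root; \<open>Lp_finite_snorm_le\<close> is the way back.\<close>

lemma Lp_finite_normalized:
  assumes f: "f \<in> pts (Lp M (ennreal p))" and p: "1 \<le> p" and n: "snorm (Lp M (ennreal p)) f < n"
  shows "integrable M (\<lambda>x. (norm (f x) / n) powr p)" "(LINT x|M. (norm (f x) / n) powr p) \<le> 1"
proof -
  have n0: "0 < n" using Lp_snorm_nonneg[OF f] n by linarith
  have int: "integrable M (\<lambda>x. norm (f x) powr p)" using f p by (simp add: Lp_finite)
  have eq: "(norm (f x) / n) powr p = norm (f x) powr p / n powr p" for x
    using n0 by (simp add: powr_divide)
  show "integrable M (\<lambda>x. (norm (f x) / n) powr p)" unfolding eq using int by simp
  have "(LINT x|M. norm (f x) powr p) = snorm (Lp M (ennreal p)) f powr p"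
    using p by (simp add: Lp_finite powr_powr)
  also have "\<dots> \<le> n powr p"
    using n p Lp_snorm_nonneg[OF f] by (intro powr_mono2) auto
  finally show "(LINT x|M. (norm (f x) / n) powr p) \<le> 1"
    unfolding eq using n0 by (simp add: divide_le_eq)
qed

lemma Lp_finite_snorm_le:
  assumes "1 \<le> p" "0 < n" and int: "integrable M (\<lambda>x. norm (f x) powr p)"
    and "(LINT x|M. (norm (f x) / n) powr p) \<le> 1"
  shows "snorm (Lp M (ennreal p)) f \<le> n"
proof -
  have "(LINT x|M. norm (f x) powr p) \<le> n powr p"
    using assms by (simp add: powr_divide divide_le_eq)
  then have "(LINT x|M. norm (f x) powr p) powr (1 / p) \<le> (n powr p) powr (1 / p)"
    using assms by (intro powr_mono2) (auto intro: integral_nonneg)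
  then show ?thesis using assms by (simp add: Lp_finite powr_powr)
qed

text \<open>
  For \<open>a\<close>, \<open>b\<close> above the two norms, \<open>(f + g) / (a + b)\<close> is a convex combination
  of \<open>f / a\<close> and \<open>g / b\<close>, which lie in the unit ball.
\<close>

lemma Lp_finite_add:
  fixes f g :: "'a \<Rightarrow> 'b::real_normed_vector"
  assumes p: "1 \<le> p" and f: "f \<in> pts (Lp M (ennreal p))" and g: "g \<in> pts (Lp M (ennreal p))"
  shows "f + g \<in> pts (Lp M (ennreal p))"
    and "snorm (Lp M (ennreal p)) (f + g) \<le> snorm (Lp M (ennreal p)) f + snorm (Lp M (ennreal p)) g"
proof -
  note sm = strongly_measurable_add[of M f g]
  have sfg: "strongly_measurable M (f + g)" using f g p by (intro sm) (auto simp: Lp_finite)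
  have *: "integrable M (\<lambda>x. norm ((f + g) x) powr p) \<and> snorm (Lp M (ennreal p)) (f + g) \<le> a + b"
    if a: "snorm (Lp M (ennreal p)) f < a" and b: "snorm (Lp M (ennreal p)) g < b" for a b
  proof -
    have a0: "0 < a" and b0: "0 < b"
      using a b Lp_snorm_nonneg[OF f] Lp_snorm_nonneg[OF g] by linarith+
    note fa = Lp_finite_normalized[OF f p a] and gb = Lp_finite_normalized[OF g p b]
    let ?h = "\<lambda>x. a / (a + b) * (norm (f x) / a) powr p + b / (a + b) * (norm (g x) / b) powr p"
    have le: "(norm ((f + g) x) / (a + b)) powr p \<le> ?h x" for x
    proof -
      have "(norm ((f + g) x) / (a + b)) powr p
          \<le> (a / (a + b) * (norm (f x) / a) + b / (a + b) * (norm (g x) / b)) powr p"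
        using a0 b0 p norm_triangle_ineq[of "f x" "g x"]
        by (intro powr_mono2) (auto simp: add_divide_distrib[symmetric] intro: divide_right_mono)
      also have "\<dots> \<le> ?h x"
        using a0 b0 p by (intro powr_convex_combination) (auto simp: add_divide_distrib[symmetric])
      finally show ?thesis .
    qed
    have inth: "integrable M ?h" using fa(1) gb(1) by simp
    have int: "integrable M (\<lambda>x. (norm ((f + g) x) / (a + b)) powr p)"
    proof (rule Bochner_Integration.integrable_bound[OF inth])
      show "(\<lambda>x. (norm ((f + g) x) / (a + b)) powr p) \<in> borel_measurable M"
        using norm_strongly_measurable[OF sfg] by measurable
      show "AE x in M. norm ((norm ((f + g) x) / (a + b)) powr p) \<le> norm (?h x)"
        using order_trans[OF le abs_ge_self] by simp
    qed
    have "(LINT x|M. (norm ((f + g) x) / (a + b)) powr p) \<le> (LINT x|M. ?h x)"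
      using int inth le by (rule integral_mono)
    also have "\<dots> = a / (a + b) * (LINT x|M. (norm (f x) / a) powr p)
        + b / (a + b) * (LINT x|M. (norm (g x) / b) powr p)"
      using fa(1) gb(1) by simp
    also have "\<dots> \<le> a / (a + b) * 1 + b / (a + b) * 1"
      using a0 b0 fa(2) gb(2) by (intro add_mono mult_left_mono) auto
    also have "\<dots> = 1" using a0 b0 by (simp add: add_divide_distrib[symmetric])
    finally have le1: "(LINT x|M. (norm ((f + g) x) / (a + b)) powr p) \<le> 1" .
    have "integrable M (\<lambda>x. norm ((f + g) x) powr p)"
      using integrable_mult_left[OF int, of "(a + b) powr p"] a0 b0 by (simp add: powr_divide)
    then show ?thesis using Lp_finite_snorm_le[OF p _ _ le1] a0 b0 by (simp del: plus_fun_apply)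
  qed
  show "f + g \<in> pts (Lp M (ennreal p))"
    using *[of "snorm (Lp M (ennreal p)) f + 1" "snorm (Lp M (ennreal p)) g + 1"] sfg p
    by (simp add: Lp_finite)
  \<comment> \<open>The strict bounds \<open>a\<close> and \<open>b\<close> decrease to the norms
    themselves.\<close>
  show "snorm (Lp M (ennreal p)) (f + g) \<le> snorm (Lp M (ennreal p)) f + snorm (Lp M (ennreal p)) g"
  proof (rule field_le_epsilon)
    fix e :: real assume "0 < e"
    then show "snorm (Lp M (ennreal p)) (f + g)
        \<le> snorm (Lp M (ennreal p)) f + snorm (Lp M (ennreal p)) g + e"
      using *[of "snorm (Lp M (ennreal p)) f + e / 2" "snorm (Lp M (ennreal p)) g + e / 2"] by simp
  qed
qed

lemma Lp_infinity_add:
  fixes f g :: "'a \<Rightarrow> 'b::real_normed_vector"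
  assumes f: "f \<in> pts (Lp M \<infinity>)" and g: "g \<in> pts (Lp M \<infinity>)"
  shows "f + g \<in> pts (Lp M \<infinity>)"
    and "snorm (Lp M \<infinity>) (f + g) \<le> snorm (Lp M \<infinity>) f + snorm (Lp M \<infinity>) g"
proof -
  have ae: "AE x in M. norm ((f + g) x) \<le> snorm (Lp M \<infinity>) f + snorm (Lp M \<infinity>) g"
    using Lp_infinity_snorm(2)[OF f] Lp_infinity_snorm(2)[OF g]
    by eventually_elim (use norm_triangle_mono in auto)
  show "f + g \<in> pts (Lp M \<infinity>)"
    using ae f g by (auto simp: Lp_def strongly_measurable_add simp del: plus_fun_apply)
  show "snorm (Lp M \<infinity>) (f + g) \<le> snorm (Lp M \<infinity>) f + snorm (Lp M \<infinity>) g"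
    using ae Lp_infinity_snorm(1)[OF f] Lp_infinity_snorm(1)[OF g]
    by (intro Lp_infinity_snorm_le) auto
qed

lemma Lp_infinity_snorm_scaleR_le:
  fixes f :: "'a \<Rightarrow> 'b::real_normed_vector"
  assumes f: "f \<in> pts (Lp M \<infinity>)"
  shows "snorm (Lp M \<infinity>) (c *\<^sub>R f) \<le> \<bar>c\<bar> * snorm (Lp M \<infinity>) f"
proof (rule Lp_infinity_snorm_le)
  show "AE x in M. norm ((c *\<^sub>R f) x) \<le> \<bar>c\<bar> * snorm (Lp M \<infinity>) f"
    using Lp_infinity_snorm(2)[OF f]
    by eventually_elim (auto simp: scaleR_fun_def intro: mult_left_mono)
qed (use Lp_infinity_snorm(1)[OF f] in auto)

text \<open>For p = \<infinity> an essential bound yields only one inequality; the other one is the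
  same inequality for \<open>c *\<^sub>R f\<close> and the factor \<open>inverse c\<close>. For
  finite exponents the root undoes the power of the factor.\<close>

lemma Lp_snorm_scaleR:
  fixes f :: "'a \<Rightarrow> 'b::real_normed_vector"
  assumes p: "1 \<le> p" and f: "f \<in> pts (Lp M p)"
  shows "snorm (Lp M p) (c *\<^sub>R f) = \<bar>c\<bar> * snorm (Lp M p) f"
proof (cases "p = \<infinity>")
  case True
  note le = Lp_infinity_snorm_scaleR_le
  show ?thesis
  proof (cases "c = 0")
    case True
    then show ?thesis
      using le[of f M c] Lp_snorm_nonneg[OF Lp_pts_scaleR[OF f, of c]] f \<open>p = \<infinity>\<close> by simp
  next
    case False
    have "snorm (Lp M p) f \<le> \<bar>inverse c\<bar> * snorm (Lp M p) (c *\<^sub>R f)"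
      using le[OF Lp_pts_scaleR[OF f, of c, unfolded \<open>p = \<infinity>\<close>], of "inverse c"] False \<open>p = \<infinity>\<close> by simp
    then have "\<bar>c\<bar> * snorm (Lp M p) f \<le> snorm (Lp M p) (c *\<^sub>R f)"
      using False by (simp add: field_simps)
    then show ?thesis using le[of f M c] f \<open>p = \<infinity>\<close> by simp
  qed
next
  case False
  then have "1 \<le> enn2real p" using p by (cases p) auto
  moreover have "norm ((c *\<^sub>R f) x) powr enn2real p = \<bar>c\<bar> powr enn2real p * norm (f x) powr enn2real p" for x
    by (simp add: scaleR_fun_def powr_mult)
  ultimately show ?thesis using False
    by (simp add: Lp_def powr_mult powr_powr)
qed

lemma normed_space_Lp:
  assumes "1 \<le> p"
  shows "normed_space (Lp M p :: ('a \<Rightarrow> 'b::real_normed_vector) nspace)"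
proof -
  have add: "f + g \<in> pts (Lp M p) \<and> snorm (Lp M p) (f + g) \<le> snorm (Lp M p) f + snorm (Lp M p) g"
    if "f \<in> pts (Lp M p)" "g \<in> pts (Lp M p)" for f g :: "'a \<Rightarrow> 'b"
  proof (cases p)
    case (real r)
    then have "1 \<le> r" using assms by simp
    then show ?thesis using Lp_finite_add[of r f M g] that real by simp
  qed (use Lp_infinity_add[of f M g] that in auto)
  have "0 \<in> pts (Lp M p :: ('a \<Rightarrow> 'b) nspace)"
    by (auto simp: Lp_def strongly_measurable_0 intro: exI[of _ 0])
  with add show ?thesis
    unfolding normed_space_def subspace_def
    by (auto simp: Lp_pts_scaleR Lp_snorm_nonneg Lp_snorm_scaleR[OF assms])
qed

text \<open>Integrating \<open>y \<le> 1 + y powr p\<close> with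
  \<open>y = \<bar>f x\<bar> / n\<close> over \<open>S\<close> and letting \<open>n\<close> decrease
  to the norm gives the bound. It takes the place of Hoelder's inequality; the constant is not
  optimal, but only continuity of the embedding into L1 of \<open>S\<close> matters.\<close>

lemma Lp_finite_integrable_on_finite_measure:
  fixes f :: "'a \<Rightarrow> real"
  assumes p: "1 \<le> p" and f: "f \<in> pts (Lp M (ennreal p))"
    and S: "S \<in> sets M" "emeasure M S < \<infinity>"
  shows "integrable (restrict_space M S) f"
    and "(LINT x|restrict_space M S. \<bar>f x\<bar>) \<le> (measure M S + 1) * snorm (Lp M (ennreal p)) f"
proof -
  have fm [measurable]: "f \<in> borel_measurable M"
    using f p by (auto simp: Lp_finite intro: strongly_measurable_imp_borel_measurable)
  let ?N = "restrict_space M S"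
  have fN: "f \<in> borel_measurable ?N" using fm by (rule measurable_restrict_space1)
  interpret finite_measure ?N
    using S by (intro finite_measureI) (simp add: emeasure_restrict_space space_restrict_space)
  have m: "measure ?N (space ?N) = measure M S"
    using S by (simp add: measure_restrict_space space_restrict_space)
  have *: "integrable ?N f \<and> (LINT x|?N. \<bar>f x\<bar>) \<le> n * (measure M S + 1)"
    if n: "snorm (Lp M (ennreal p)) f < n" for n
  proof -
    have n0: "0 < n" using Lp_snorm_nonneg[OF f] n by linarith
    note fn = Lp_finite_normalized[OF f p n]
    let ?g = "\<lambda>x. (norm (f x) / n) powr p"
    have intg: "integrable ?N ?g" 
      using integrable_mult_indicator[OF S(1) fn(1)] S
      by (simp add: integrable_restrict_space)
    have "(LINT x|?N. ?g x) = (LINT x|M. indicator S x *\<^sub>R ?g x)"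
      using S by (simp add: integral_restrict_space)
    also have "\<dots> \<le> (LINT x|M. ?g x)"
      using fn(1) integrable_mult_indicator[OF S(1) fn(1)]
      by (intro integral_mono) (auto split: split_indicator)
    finally have g1: "(LINT x|?N. ?g x) \<le> 1" using fn(2) by simp
    have le: "\<bar>f x\<bar> \<le> n * (1 + ?g x)" for x
    proof -
      have "y \<le> 1 + y powr p" if "0 \<le> y" for y :: real
      proof (cases "y \<le> 1")
        case False
        then show ?thesis using powr_mono[of 1 p y] p by simp
      qed (simp add: add_increasing2)
      from this[of "\<bar>f x\<bar> / n"] show ?thesis using n0 by (simp add: field_simps)
    qed
    have inth: "integrable ?N (\<lambda>x. n * (1 + ?g x))" using intg by simp
    have intf: "integrable ?N f"
      by (rule Bochner_Integration.integrable_bound[OF inth fN])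
        (use order_trans[OF le abs_ge_self] in simp)
    have "(LINT x|?N. \<bar>f x\<bar>) \<le> (LINT x|?N. n * (1 + ?g x))"
      using intf inth le by (intro integral_mono) auto
    also have "\<dots> = n * (measure M S + (LINT x|?N. ?g x))" using intg m by simp
    also have "\<dots> \<le> n * (measure M S + 1)" using g1 n0 by simp
    finally show ?thesis using intf by simp
  qed
  show "integrable ?N f" using *[of "snorm (Lp M (ennreal p)) f + 1"] by simp
  show "(LINT x|?N. \<bar>f x\<bar>) \<le> (measure M S + 1) * snorm (Lp M (ennreal p)) f"
  proof (rule field_le_epsilon)
    fix e :: real assume "0 < e"
    \<comment> \<open>The bound for \<open>n\<close> carries the factor \<open>m\<close>, so the
      slack has to be \<open>e / m\<close>; the summand 1 keeps \<open>m\<close> positive when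
      \<open>S\<close> is a null set.\<close>
    define m where "m = measure M S + 1"
    have "0 < m" by (simp add: m_def add_nonneg_pos)
    with \<open>0 < e\<close> have "0 < e / m" by simp
    then have "(LINT x|?N. \<bar>f x\<bar>) \<le> (snorm (Lp M (ennreal p)) f + e / m) * m"
      using *[of "snorm (Lp M (ennreal p)) f + e / m"] by (simp add: m_def)
    also have "\<dots> = m * snorm (Lp M (ennreal p)) f + e"
      using \<open>0 < m\<close> by (simp add: distrib_right)
    finally show "(LINT x|?N. \<bar>f x\<bar>) \<le> (measure M S + 1) * snorm (Lp M (ennreal p)) f + e"
      by (simp add: m_def)
  qed
qed

section \<open>Smoothed plus function\<close>

text \<open>The substitution x / \<delta> preserves mass 1 and finiteness of the first moment. The
  mass bounds \<open>smooth_step\<close> by 1. The moment makes \<open>smooth_step\<close>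
  integrable at minus infinity, without which the integral defining \<open>smooth_plus\<close> would
  be 0 by default.\<close>

lemma kernel_scaled:
  assumes "smoothing_kernel \<zeta>" "0 < \<delta>"
  shows "continuous_on UNIV (\<lambda>x. 1 / \<delta> * \<zeta> (x / \<delta>))" "\<And>x. 0 \<le> 1 / \<delta> * \<zeta> (x / \<delta>)"
    "has_bochner_integral lborel (\<lambda>x. 1 / \<delta> * \<zeta> (x / \<delta>)) 1"
    "integrable lborel (\<lambda>x. 1 / \<delta> * \<zeta> (x / \<delta>) * \<bar>x\<bar>)"
proof -
  have c: "continuous_on UNIV \<zeta>" and nn: "\<And>x. 0 \<le> \<zeta> x"
    and i: "has_bochner_integral lborel \<zeta> 1" and m: "integrable lborel (\<lambda>x. \<zeta> x * \<bar>x\<bar>)"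
    using assms by (auto simp: smoothing_kernel_def)
  show "continuous_on UNIV (\<lambda>x. 1 / \<delta> * \<zeta> (x / \<delta>))"
    by (intro continuous_intros continuous_on_compose2[OF c]) (use assms in auto)
  show "0 \<le> 1 / \<delta> * \<zeta> (x / \<delta>)" for x using nn assms by simp
  have "has_bochner_integral lborel (\<lambda>x. \<zeta> (x / \<delta>)) \<delta>"
    using lborel_has_bochner_integral_real_affine_iff[of "1 / \<delta>" \<zeta> 1 0] i assms(2) by simp
  from has_bochner_integral_mult_right[OF this, of "1 / \<delta>"] assms(2)
  show "has_bochner_integral lborel (\<lambda>x. 1 / \<delta> * \<zeta> (x / \<delta>)) 1" by simp
  show "integrable lborel (\<lambda>x. 1 / \<delta> * \<zeta> (x / \<delta>) * \<bar>x\<bar>)"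
    using lborel_integrable_real_affine[OF m, of "1 / \<delta>" 0] assms(2) by simp
qed

text \<open>The part of the integral below a fixed \<open>a < x\<close> is constant near
  \<open>x\<close>, and from \<open>a\<close> on the fundamental theorem of calculus on a compact
  interval applies. The lemma serves twice, for \<open>smooth_step\<close> and for
  \<open>smooth_plus\<close>.\<close>

lemma set_integral_atMost_has_derivative:
  fixes f :: "real \<Rightarrow> real"
  assumes int: "\<And>x. set_integrable lborel {..x} f" and f: "continuous_on UNIV f"
  shows "((\<lambda>x. LINT y:{..x}|lborel. f y) has_real_derivative f x) (at x)"
proof -
  define a b where "a = x - 1" and "b = x + 1"
  have ab: "a < x" "x < b" by (auto simp: a_def b_def)
  have split: "(LINT z:{..a}|lborel. f z) + integral {a..y} f = (LINT z:{..y}|lborel. f z)"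
    if "a \<le> y" for y
  proof -
    have si: "set_integrable lborel {a..y} f"
      using set_integrable_subset[OF int[of y]] by auto
    \<comment> \<open>The two pieces overlap in the single point \<open>a\<close>, a null
      set.\<close>
    have "AE z in lborel. z \<noteq> a" by (rule AE_lborel_singleton)
    then have ae: "AE z in lborel. \<not> (z \<in> {..a} \<and> z \<in> {a..y})" by eventually_elim auto
    have "{..y} = {..a} \<union> {a..y}" using that by auto
    then show ?thesis
      using set_integral_Un_AE[OF ae _ _ int si] set_borel_integral_eq_integral(2)[OF si] by simp
  qed
  have "((\<lambda>y. integral {a..y} f) has_real_derivative f x) (at x within {a..b})"
    using ab by (intro integral_has_real_derivative continuous_on_subset[OF f]) auto
  then have "((\<lambda>y. integral {a..y} f) has_real_derivative f x) (at x)"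
    unfolding at_within_Icc_at[OF ab] .
  then have "((\<lambda>y. (LINT z:{..a}|lborel. f z) + integral {a..y} f) has_real_derivative f x) (at x)"
    by (auto intro!: derivative_eq_intros)
  then show ?thesis
    by (rule has_field_derivative_transform_within_open[of _ _ _ "{a<..<b}"]) (use ab split in auto)
qed

text \<open>By Tonelli, the integral of \<open>\<tau> \<mapsto> \<integral>\<^bsub>-\<infinity>\<^esub>\<^bsup>\<tau>\<^esup> k\<close> up to \<open>x\<close> is \<open>\<integral>\<^bsub>-\<infinity>\<^esub>\<^bsup>x\<^esup> k(\<sigma>) (x - \<sigma>) d\<sigma>\<close>.\<close>

lemma set_integrable_iterated_atMost:
  fixes k :: "real \<Rightarrow> real"
  assumes k: "\<And>x. 0 \<le> k x" and int: "integrable lborel k" and moment: "integrable lborel (\<lambda>x. k x * \<bar>x\<bar>)"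
    and [measurable]: "(\<lambda>\<tau>. LINT \<sigma>:{..\<tau>}|lborel. k \<sigma>) \<in> borel_measurable borel"
  shows "set_integrable lborel {..x} (\<lambda>\<tau>. LINT \<sigma>:{..\<tau>}|lborel. k \<sigma>)"
proof -
  let ?K = "\<lambda>\<tau>. LINT \<sigma>:{..\<tau>}|lborel. k \<sigma>"
  have km [measurable]: "k \<in> borel_measurable borel"
    using int by auto
  have K: "ennreal (?K \<tau>) = (\<integral>\<^sup>+\<sigma>. indicator {..\<tau>} \<sigma> * ennreal (k \<sigma>) \<partial>lborel)" for \<tau>
  proof -
    have "ennreal (?K \<tau>) = (\<integral>\<^sup>+\<sigma>. ennreal (indicator {..\<tau>} \<sigma> *\<^sub>R k \<sigma>) \<partial>lborel)"
      unfolding set_lebesgue_integral_def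
      using k integrable_mult_indicator[OF _ int, of "{..\<tau>}"]
      by (intro nn_integral_eq_integral[symmetric]) auto
    also have "\<dots> = (\<integral>\<^sup>+\<sigma>. indicator {..\<tau>} \<sigma> * ennreal (k \<sigma>) \<partial>lborel)"
      by (intro nn_integral_cong) (auto split: split_indicator)
    finally show ?thesis .
  qed
  have K0: "0 \<le> ?K \<tau>" for \<tau>
    unfolding set_lebesgue_integral_def using k by (intro Bochner_Integration.integral_nonneg) simp
  have "(\<integral>\<^sup>+\<tau>. ennreal (norm (indicator {..x} \<tau> *\<^sub>R ?K \<tau>)) \<partial>lborel)
      = (\<integral>\<^sup>+\<tau>. indicator {..x} \<tau> * ennreal (?K \<tau>) \<partial>lborel)"
    using K0 by (intro nn_integral_cong) (auto split: split_indicator)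
  also have "\<dots> = (\<integral>\<^sup>+\<tau>. (\<integral>\<^sup>+\<sigma>. (if \<sigma> \<le> \<tau> \<and> \<tau> \<le> x then 1 else 0) * ennreal (k \<sigma>) \<partial>lborel) \<partial>lborel)"
    unfolding K
    by (subst nn_integral_cmult[symmetric]) (auto intro!: nn_integral_cong split: split_indicator)
  also have "\<dots> = (\<integral>\<^sup>+\<sigma>. (\<integral>\<^sup>+\<tau>. (if \<sigma> \<le> \<tau> \<and> \<tau> \<le> x then 1 else 0) * ennreal (k \<sigma>) \<partial>lborel) \<partial>lborel)"
    by (rule lborel_pair.Fubini') measurable
  also have "\<dots> = (\<integral>\<^sup>+\<sigma>. (\<integral>\<^sup>+\<tau>. ennreal (k \<sigma>) * indicator {\<sigma>..x} \<tau> \<partial>lborel) \<partial>lborel)"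
    by (auto intro!: nn_integral_cong split: split_indicator)
  also have "\<dots> = (\<integral>\<^sup>+\<sigma>. ennreal (k \<sigma>) * emeasure lborel {\<sigma>..x} \<partial>lborel)"
    by (simp add: nn_integral_cmult_indicator)
  also have "\<dots> \<le> (\<integral>\<^sup>+\<sigma>. ennreal (k \<sigma> * \<bar>x\<bar> + k \<sigma> * \<bar>\<sigma>\<bar>) \<partial>lborel)"
  proof (rule nn_integral_mono)
    fix \<sigma>
    \<comment> \<open>The length is max(0, x - \<sigma>); estimating it by \<bar>x\<bar> +
      \<bar>\<sigma>\<bar> is what brings in the first moment of \<open>k\<close>.\<close>
    have "emeasure lborel {\<sigma>..x} \<le> ennreal (\<bar>x\<bar> + \<bar>\<sigma>\<bar>)"
      by (cases "\<sigma> \<le> x") (auto intro: ennreal_leI simp del: ennreal_plus)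
    then have "ennreal (k \<sigma>) * emeasure lborel {\<sigma>..x} \<le> ennreal (k \<sigma>) * ennreal (\<bar>x\<bar> + \<bar>\<sigma>\<bar>)"
      by (rule mult_left_mono) simp
    also have "\<dots> = ennreal (k \<sigma> * \<bar>x\<bar> + k \<sigma> * \<bar>\<sigma>\<bar>)"
      using k[of \<sigma>] by (subst ennreal_mult[symmetric]) (auto simp: distrib_left)
    finally show "ennreal (k \<sigma>) * emeasure lborel {\<sigma>..x} \<le> ennreal (k \<sigma> * \<bar>x\<bar> + k \<sigma> * \<bar>\<sigma>\<bar>)" .
  qed
  also have "\<dots> < \<infinity>"
    using k int moment by (subst nn_integral_eq_integral) auto
  finally show ?thesis
    unfolding set_integrable_def by (intro integrableI_bounded) measurable
qed

context
  fixes \<zeta> :: "real \<Rightarrow> real" and \<delta> :: real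
  assumes kernel: "smoothing_kernel \<zeta>" and \<delta>: "0 < \<delta>"
begin

lemma kernel_set_integrable:
  assumes "S \<in> sets lborel"
  shows "set_integrable lborel S (\<lambda>x. 1 / \<delta> * \<zeta> (x / \<delta>))"
  unfolding set_integrable_def
  by (rule integrable_mult_indicator[OF assms integrable.intros[OF kernel_scaled(3)[OF kernel \<delta>]]])

lemma smooth_step_has_derivative:
  "(smooth_step \<zeta> \<delta> has_real_derivative 1 / \<delta> * \<zeta> (x / \<delta>)) (at x)"
  unfolding smooth_step_def[abs_def]
  by (rule set_integral_atMost_has_derivative[OF kernel_set_integrable kernel_scaled(1)[OF kernel \<delta>]]) simp

lemma smooth_step_continuous: "continuous_on UNIV (smooth_step \<zeta> \<delta>)"
  by (meson DERIV_isCont continuous_at_imp_continuous_on smooth_step_has_derivative)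

lemma smooth_step_measurable [measurable]: "smooth_step \<zeta> \<delta> \<in> borel_measurable borel"
  by (rule borel_measurable_continuous_onI[OF smooth_step_continuous])

lemma smooth_step_nonneg: "0 \<le> smooth_step \<zeta> \<delta> x"
  unfolding smooth_step_def set_lebesgue_integral_def
  by (intro Bochner_Integration.integral_nonneg scaleR_nonneg_nonneg kernel_scaled(2)[OF kernel \<delta>]) auto

lemma smooth_step_le_1: "smooth_step \<zeta> \<delta> x \<le> 1"
proof -
  note k = kernel_scaled[OF kernel \<delta>]
  have "smooth_step \<zeta> \<delta> x \<le> (LINT x|lborel. 1 / \<delta> * \<zeta> (x / \<delta>))"
    unfolding smooth_step_def set_lebesgue_integral_def
  proof (rule integral_mono)
    show "indicator {..x} y *\<^sub>R (1 / \<delta> * \<zeta> (y / \<delta>)) \<le> 1 / \<delta> * \<zeta> (y / \<delta>)" for y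
      using k(2)[of y] by (auto split: split_indicator)
    show "integrable lborel (\<lambda>y. 1 / \<delta> * \<zeta> (y / \<delta>))"
      by (rule integrable.intros[OF k(3)])
  qed (use kernel_set_integrable[of "{..x}"] in \<open>simp add: set_integrable_def\<close>)
  then show ?thesis using k(3) by (simp add: has_bochner_integral_iff)
qed

lemma smooth_step_set_integrable: "set_integrable lborel {..x} (smooth_step \<zeta> \<delta>)"
  using set_integrable_iterated_atMost[OF kernel_scaled(2)[OF kernel \<delta>]
      integrable.intros[OF kernel_scaled(3)[OF kernel \<delta>]] kernel_scaled(4)[OF kernel \<delta>]]
    smooth_step_measurable
  unfolding smooth_step_def[abs_def] .

lemma smooth_plus_has_derivative:
  "(smooth_plus \<zeta> \<delta> has_real_derivative smooth_step \<zeta> \<delta> x) (at x)"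
  unfolding smooth_plus_def[abs_def]
  by (rule set_integral_atMost_has_derivative[OF smooth_step_set_integrable smooth_step_continuous])

lemma smooth_plus_measurable [measurable]: "smooth_plus \<zeta> \<delta> \<in> borel_measurable borel"
  by (meson DERIV_isCont continuous_at_imp_continuous_on smooth_plus_has_derivative
      borel_measurable_continuous_onI)

text \<open>The derivative \<open>smooth_step\<close> lies between 0 and 1, hence the constant 1,
  whatever \<delta> is.\<close>

lemma smooth_plus_lipschitz: "\<bar>smooth_plus \<zeta> \<delta> x - smooth_plus \<zeta> \<delta> y\<bar> \<le> \<bar>x - y\<bar>"
  using field_differentiable_bound[of UNIV "smooth_plus \<zeta> \<delta>" "smooth_step \<zeta> \<delta>" 1 x y]
    smooth_plus_has_derivative smooth_step_nonneg smooth_step_le_1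
  by (auto simp: has_field_derivative_at_within)

end

section \<open>Frechet derivatives\<close>

context
  fixes X :: "'a::real_vector nspace"
  assumes X: "normed_space X"
begin

lemma pts_add: "x \<in> pts X \<Longrightarrow> y \<in> pts X \<Longrightarrow> x + y \<in> pts X"
  and pts_scaleR: "x \<in> pts X \<Longrightarrow> c *\<^sub>R x \<in> pts X"
  and pts_diff: "x \<in> pts X \<Longrightarrow> y \<in> pts X \<Longrightarrow> x - y \<in> pts X"
  using X unfolding normed_space_def by (auto intro: subspace_add subspace_mul subspace_diff)

lemma snorm_nonneg: "x \<in> pts X \<Longrightarrow> 0 \<le> snorm X x"
  and snorm_triangle: "x \<in> pts X \<Longrightarrow> y \<in> pts X \<Longrightarrow> snorm X (x + y) \<le> snorm X x + snorm X y"
  and snorm_scaleR: "x \<in> pts X \<Longrightarrow> snorm X (c *\<^sub>R x) = \<bar>c\<bar> * snorm X x"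
  using X unfolding normed_space_def by auto

lemma snorm_triangle_diff:
  assumes "x \<in> pts X" "y \<in> pts X" "z \<in> pts X"
  shows "snorm X (x - z) \<le> snorm X (x - y) + snorm X (y - z)"
  using snorm_triangle[of "x - y" "y - z"] assms by (simp add: pts_diff)

lemma snorm_le_add_diff:
  assumes "x \<in> pts X" "y \<in> pts X"
  shows "snorm X x \<le> snorm X (x - y) + snorm X y"
  using snorm_triangle[of "x - y" y] assms by (simp add: pts_diff)

end

lemma normed_space_type_space: "normed_space (type_space :: 'a::real_normed_vector nspace)"
  by (auto simp: normed_space_def type_space_def norm_triangle_ineq)

text \<open>\<open>f x - f y\<close> agrees with \<open>f (x - y)\<close> only up to an element of
  norm 0, so the Lipschitz bound needs a triangle inequality. The maximum with 1 makes
  \<open>K\<close> positive, so that the chain rule can divide by such a constant.\<close>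

lemma bounded_linear_map_diff_bound:
  assumes X: "normed_space X" and Y: "normed_space Y" and f: "bounded_linear_map X Y f"
  obtains K where "0 < K" "\<And>x. x \<in> pts X \<Longrightarrow> snorm Y (f x) \<le> K * snorm X x"
    "\<And>x y. x \<in> pts X \<Longrightarrow> y \<in> pts X \<Longrightarrow> snorm Y (f x - f y) \<le> K * snorm X (x - y)"
proof -
  have mem: "\<And>x. x \<in> pts X \<Longrightarrow> f x \<in> pts Y"
    and add: "\<And>x y. x \<in> pts X \<Longrightarrow> y \<in> pts X \<Longrightarrow> snorm Y (f (x + y) - (f x + f y)) = 0"
    using f unfolding bounded_linear_map_def by auto
  obtain K where K: "\<And>x. x \<in> pts X \<Longrightarrow> snorm Y (f x) \<le> K * snorm X x"
    using f unfolding bounded_linear_map_def by blast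
  have K': "snorm Y (f x) \<le> max K 1 * snorm X x" if "x \<in> pts X" for x
    using K[OF that] snorm_nonneg[OF X that] mult_right_mono[of K "max K 1"] by fastforce
  have "snorm Y (f x - f y) \<le> max K 1 * snorm X (x - y)" if "x \<in> pts X" "y \<in> pts X" for x y
  proof -
    have xy: "x - y \<in> pts X" using that by (rule pts_diff[OF X])
    have "snorm Y (f x - f y) \<le> snorm Y ((f x - f y) - f (x - y)) + snorm Y (f (x - y))"
      using that xy by (intro snorm_le_add_diff[OF Y] pts_diff[OF Y] mem)
    also have "snorm Y ((f x - f y) - f (x - y)) = 0"
      using add[OF xy that(2)] by (simp add: algebra_simps)
    finally show ?thesis using K'[OF xy] by simp
  qed
  with K' show thesis by (intro that[of "max K 1"]) auto
qed

lemma bounded_linear_map_compose: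
  assumes X: "normed_space X" and Y: "normed_space Y" and Z: "normed_space Z"
    and f: "bounded_linear_map X Y f" and g: "bounded_linear_map Y Z g"
  shows "bounded_linear_map X Z (\<lambda>x. g (f x))"
proof -
  obtain K where K: "0 < K" "\<And>x. x \<in> pts X \<Longrightarrow> snorm Y (f x) \<le> K * snorm X x"
    using bounded_linear_map_diff_bound[OF X Y f] by metis
  obtain L where L: "0 < L" "\<And>x. x \<in> pts Y \<Longrightarrow> snorm Z (g x) \<le> L * snorm Y x"
    "\<And>x y. x \<in> pts Y \<Longrightarrow> y \<in> pts Y \<Longrightarrow> snorm Z (g x - g y) \<le> L * snorm Y (x - y)"
    using bounded_linear_map_diff_bound[OF Y Z g] by metis
  have fm: "\<And>x. x \<in> pts X \<Longrightarrow> f x \<in> pts Y" and gm: "\<And>x. x \<in> pts Y \<Longrightarrow> g x \<in> pts Z"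
    using f g unfolding bounded_linear_map_def by auto
  \<comment> \<open>\<open>g\<close> maps elements at distance 0 to elements at distance 0, so the
    linearity defects of \<open>f\<close> pass through \<open>g\<close> without harm.\<close>
  have null: "snorm Z (g a - c) = 0"
    if "a \<in> pts Y" "b \<in> pts Y" "c \<in> pts Z" "snorm Y (a - b) = 0" "snorm Z (g b - c) = 0" for a b c
  proof (rule antisym)
    show "snorm Z (g a - c) \<le> 0"
      using snorm_triangle_diff[OF Z gm gm that(3), OF that(1,2)] L(3)[OF that(1,2)] that by simp
    show "0 \<le> snorm Z (g a - c)" using that by (intro snorm_nonneg[OF Z] pts_diff[OF Z] gm)
  qed
  have "snorm Z (g (f (x + y)) - (g (f x) + g (f y))) = 0" if "x \<in> pts X" "y \<in> pts X" for x y
    using f g that fm gm pts_add[OF X] pts_add[OF Y] pts_add[OF Z] unfolding bounded_linear_map_def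
    by (intro null[of "f (x + y)" "f x + f y"]) auto
  moreover have "snorm Z (g (f (c *\<^sub>R x)) - c *\<^sub>R g (f x)) = 0" if "x \<in> pts X" for c x
    using f g that fm gm pts_scaleR[OF X] pts_scaleR[OF Y] pts_scaleR[OF Z] unfolding bounded_linear_map_def
    by (intro null[of "f (c *\<^sub>R x)" "c *\<^sub>R f x"]) auto
  moreover have "snorm Z (g (f x)) \<le> (L * K) * snorm X x" if "x \<in> pts X" for x
    using order_trans[OF L(2)[OF fm[OF that]] mult_left_mono[OF K(2)[OF that], of L]] L(1)
    by (simp add: mult.assoc)
  ultimately show ?thesis unfolding bounded_linear_map_def using fm gm by blast
qed

text \<open>With the increment \<open>k = f (x + h) - f x\<close> the remainder splits into the
  remainder of \<open>g\<close> at \<open>k\<close> and the difference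
  \<open>g' k - g' (f' h)\<close>, which the Lipschitz bound of \<open>g'\<close> controls. Each
  part contributes at most \<open>e / 2 * snorm X h\<close>.\<close>

lemma has_frechet_derivative_compose:
  assumes X: "normed_space X" and Y: "normed_space Y" and Z: "normed_space Z"
    and f: "has_frechet_derivative X Y D f f' x" and x: "x \<in> D"
    and g: "has_frechet_derivative Y Z E g g' (f x)" and E: "\<And>y. y \<in> D \<Longrightarrow> f y \<in> E"
  shows "has_frechet_derivative X Z D (\<lambda>y. g (f y)) (\<lambda>h. g' (f' h)) x"
proof -
  have lf: "bounded_linear_map X Y f'" and lg: "bounded_linear_map Y Z g'"
    and fD: "\<And>y. y \<in> D \<Longrightarrow> f y \<in> pts Y" and gE: "\<And>y. y \<in> E \<Longrightarrow> g y \<in> pts Z"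
    using f g unfolding has_frechet_derivative_def by auto
  have f'm: "\<And>x. x \<in> pts X \<Longrightarrow> f' x \<in> pts Y" and g'm: "\<And>x. x \<in> pts Y \<Longrightarrow> g' x \<in> pts Z"
    using lf lg unfolding bounded_linear_map_def by auto
  obtain K where K: "0 < K" "\<And>x. x \<in> pts X \<Longrightarrow> snorm Y (f' x) \<le> K * snorm X x"
    using bounded_linear_map_diff_bound[OF X Y lf] by metis
  obtain L where L: "0 < L"
    "\<And>x y. x \<in> pts Y \<Longrightarrow> y \<in> pts Y \<Longrightarrow> snorm Z (g' x - g' y) \<le> L * snorm Y (x - y)"
    using bounded_linear_map_diff_bound[OF Y Z lg] by metis
  have "\<exists>d>0. \<forall>h\<in>pts X. x + h \<in> D \<and> snorm X h < d \<longrightarrow>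
      snorm Z (g (f (x + h)) - g (f x) - g' (f' h)) \<le> e * snorm X h" if e: "0 < e" for e
  proof -
    \<comment> \<open>The cap 1 in \<open>e1\<close> gives
      \<open>snorm Y k \<le> (K + 1) * snorm X h\<close>. The factor \<open>K + 1\<close> is divided
      out in \<open>e2\<close>, the factor \<open>L\<close> in the other bound of
      \<open>e1\<close>.\<close>
    define e1 e2 where "e1 = min 1 (e / (2 * L))" and "e2 = e / (2 * (K + 1))"
    have e12: "0 < e1" "0 < e2" using e K L by (auto simp: e1_def e2_def)
    obtain d1 where d1: "0 < d1" "\<And>h. h \<in> pts X \<Longrightarrow> x + h \<in> D \<Longrightarrow> snorm X h < d1
        \<Longrightarrow> snorm Y (f (x + h) - f x - f' h) \<le> e1 * snorm X h"
      using f e12 unfolding has_frechet_derivative_def by meson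
    obtain d2 where d2: "0 < d2" "\<And>k. k \<in> pts Y \<Longrightarrow> f x + k \<in> E \<Longrightarrow> snorm Y k < d2
        \<Longrightarrow> snorm Z (g (f x + k) - g (f x) - g' k) \<le> e2 * snorm Y k"
      using g e12 unfolding has_frechet_derivative_def by meson
    define d where "d = min d1 (d2 / (K + 1))"
    have "snorm Z (g (f (x + h)) - g (f x) - g' (f' h)) \<le> e * snorm X h"
      if h: "h \<in> pts X" "x + h \<in> D" "snorm X h < d" for h
    proof -
      define k where "k = f (x + h) - f x"
      have k: "k \<in> pts Y" unfolding k_def using h x by (intro pts_diff[OF Y] fD)
      have h0: "0 \<le> snorm X h" using h by (intro snorm_nonneg[OF X])
      have kf: "snorm Y (k - f' h) \<le> e1 * snorm X h"
        unfolding k_def using h d1 by (auto simp: d_def)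
      have "snorm Y k \<le> snorm Y (k - f' h) + snorm Y (f' h)"
        using k h by (intro snorm_le_add_diff[OF Y] f'm)
      also have "\<dots> \<le> 1 * snorm X h + K * snorm X h"
        using kf K(2)[OF h(1)] h0 mult_right_mono[of e1 1 "snorm X h"] by (simp add: e1_def)
      finally have kK: "snorm Y k \<le> (K + 1) * snorm X h" by (simp add: algebra_simps)
      also have "\<dots> < d2" using h K by (simp add: d_def field_simps)
      finally have "snorm Z (g (f x + k) - g (f x) - g' k) \<le> e2 * snorm Y k"
        using d2(2)[OF k] E[OF h(2)] by (simp add: k_def)
      also have "\<dots> \<le> e2 * ((K + 1) * snorm X h)"
        using kK e12 by (intro mult_left_mono) auto
      also have "\<dots> = e / 2 * snorm X h" using K by (simp add: e2_def field_simps)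
      finally have 1: "snorm Z (g (f (x + h)) - g (f x) - g' k) \<le> e / 2 * snorm X h"
        by (simp add: k_def)
      have "snorm Z (g' k - g' (f' h)) \<le> L * snorm Y (k - f' h)"
        using k h by (intro L(2) f'm)
      also have "\<dots> \<le> L * (e / (2 * L) * snorm X h)"
        using kf L(1) h0 mult_right_mono[of e1 "e / (2 * L)" "snorm X h"]
        by (intro mult_left_mono) (auto simp: e1_def)
      also have "\<dots> = e / 2 * snorm X h" using L(1) by simp
      finally have 2: "snorm Z (g' k - g' (f' h)) \<le> e / 2 * snorm X h" .
      have "snorm Z ((g (f (x + h)) - g (f x)) - g' (f' h))
          \<le> snorm Z ((g (f (x + h)) - g (f x)) - g' k) + snorm Z (g' k - g' (f' h))"
        using h x k by (intro snorm_triangle_diff[OF Z] pts_diff[OF Z] g'm f'm gE E)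
      with 1 2 show ?thesis by (simp add: field_simps)
    qed
    moreover have "0 < d" using d1 d2 K by (simp add: d_def)
    ultimately show ?thesis by blast
  qed
  then show ?thesis
    unfolding has_frechet_derivative_def
    using bounded_linear_map_compose[OF X Y Z lf lg] gE E by blast
qed

text \<open>The remainder is stated with \<open>r n *\<^sub>R f' h\<close> because the linearization
  of the integrand needs one fixed direction \<open>f' h\<close>. Replacing
  \<open>f' (r n *\<^sub>R h)\<close> by it costs an element of norm 0.\<close>

lemma has_frechet_derivative_directional:
  assumes X: "normed_space X" and Y: "normed_space Y"
    and f: "has_frechet_derivative X Y D f f' x" and x: "x \<in> D" and h: "h \<in> pts X"
    and r: "\<And>n. 0 < r n" "r \<longlonglongrightarrow> (0::real)" and D: "\<And>n. x + r n *\<^sub>R h \<in> D"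
  shows "(\<lambda>n. snorm Y (f (x + r n *\<^sub>R h) - f x - r n *\<^sub>R f' h) / r n) \<longlonglongrightarrow> 0"
proof (rule LIMSEQ_I)
  fix e :: real assume e: "0 < e"
  have lf: "bounded_linear_map X Y f'" and fD: "\<And>y. y \<in> D \<Longrightarrow> f y \<in> pts Y"
    using f unfolding has_frechet_derivative_def by auto
  have f'm: "\<And>x. x \<in> pts X \<Longrightarrow> f' x \<in> pts Y"
    and sc: "\<And>c. snorm Y (f' (c *\<^sub>R h) - c *\<^sub>R f' h) = 0"
    using lf h unfolding bounded_linear_map_def by auto
  have h0: "0 \<le> snorm X h" using h by (rule snorm_nonneg[OF X])
  \<comment> \<open>The added 1 allows for \<open>snorm X h = 0\<close>.\<close>
  define e' where "e' = e / (snorm X h + 1)"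
  have e': "0 < e'" using e h0 by (simp add: e'_def)
  obtain d where d: "0 < d" "\<And>h. h \<in> pts X \<Longrightarrow> x + h \<in> D \<Longrightarrow> snorm X h < d
      \<Longrightarrow> snorm Y (f (x + h) - f x - f' h) \<le> e' * snorm X h"
    using f e' unfolding has_frechet_derivative_def by meson
  obtain N where N: "\<And>n. N \<le> n \<Longrightarrow> r n < d / (snorm X h + 1)"
    using order_tendstoD(2)[OF r(2), of "d / (snorm X h + 1)"] d h0
    by (auto simp: eventually_sequentially)
  have "norm (snorm Y (f (x + r n *\<^sub>R h) - f x - r n *\<^sub>R f' h) / r n - 0) < e" if "N \<le> n" for n
  proof -
    have rh: "r n *\<^sub>R h \<in> pts X" using h by (rule pts_scaleR[OF X])
    have nrh: "snorm X (r n *\<^sub>R h) = r n * snorm X h"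
      using snorm_scaleR[OF X h, of "r n"] r(1)[of n] by simp
    have "r n * snorm X h \<le> r n * (snorm X h + 1)" using r(1)[of n] by simp
    also have "\<dots> < d" using N[OF that] h0 by (simp add: field_simps)
    finally have "snorm X (r n *\<^sub>R h) < d" by (simp add: nrh)
    then have 1: "snorm Y (f (x + r n *\<^sub>R h) - f x - f' (r n *\<^sub>R h)) \<le> e' * (r n * snorm X h)"
      using d(2)[OF rh D] nrh by simp
    let ?v = "f (x + r n *\<^sub>R h) - f x - r n *\<^sub>R f' h"
    have "snorm Y ?v \<le> snorm Y (f (x + r n *\<^sub>R h) - f x - f' (r n *\<^sub>R h))
        + snorm Y (f' (r n *\<^sub>R h) - r n *\<^sub>R f' h)"
      using x rh h D by (intro snorm_triangle_diff[OF Y] pts_diff[OF Y] fD f'm pts_scaleR[OF Y])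
    with 1 sc have "snorm Y ?v \<le> e' * snorm X h * r n" by (simp add: algebra_simps)
    then have "snorm Y ?v / r n \<le> e' * snorm X h" using r(1)[of n] by (simp add: divide_le_eq)
    also have "\<dots> < e" using e h0 by (simp add: e'_def field_simps)
    finally have "snorm Y ?v / r n < e" .
    moreover have "0 \<le> snorm Y ?v"
      using x h D by (intro snorm_nonneg[OF Y] pts_diff[OF Y] fD f'm pts_scaleR[OF Y])
    ultimately show ?thesis using r(1)[of n] by simp
  qed
  then show "\<exists>N. \<forall>n\<ge>N. norm (snorm Y (f (x + r n *\<^sub>R h) - f x - r n *\<^sub>R f' h) / r n - 0) < e"
    by blast
qed

text \<open>The derivative of \<open>f\<^sub>0\<close> is given in the type-class sense; the
  transfer lets one lemma on difference quotients treat both \<open>f\<^sub>0\<close> and the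
  penalty \<open>H\<close>. The whole type can serve as the domain because the real-valued form of
  \<open>f\<^sub>0\<close> is total.\<close>

lemma has_derivative_imp_has_frechet_derivative:
  assumes "(f has_derivative f') (at x)"
  shows "has_frechet_derivative type_space type_space UNIV f f' x"
proof -
  have bl: "bounded_linear f'"
    and d: "\<forall>e>0. \<exists>d>0. \<forall>y. norm (y - x) < d \<longrightarrow> norm (f y - f x - f' (y - x)) \<le> e * norm (y - x)"
    using assms unfolding has_derivative_at_alt by blast+
  interpret bounded_linear f' by fact
  obtain K where "\<forall>x. norm (f' x) \<le> norm x * K" using bounded by blast
  then have K: "\<forall>x. norm (f' x) \<le> K * norm x" by (simp add: mult.commute)
  have "bounded_linear_map type_space type_space f'"
    unfolding bounded_linear_map_def
  proof (intro conjI ballI allI)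
    show "snorm type_space (f' (x + y) - (f' x + f' y)) = 0" for x y
      unfolding add by (simp add: type_space_def)
    show "snorm type_space (f' (c *\<^sub>R x) - c *\<^sub>R f' x) = 0" for c x
      unfolding scaleR by (simp add: type_space_def)
    show "\<exists>K. \<forall>x\<in>pts type_space. snorm type_space (f' x) \<le> K * snorm type_space x"
      using K by (auto simp: type_space_def)
  qed (simp add: type_space_def)
  moreover have "\<exists>d>0. \<forall>h. norm h < d \<longrightarrow> norm (f (x + h) - f x - f' h) \<le> e * norm h" if e: "0 < e" for e
  proof -
    obtain d where d0: "0 < d"
      and d: "\<And>y. norm (y - x) < d \<Longrightarrow> norm (f y - f x - f' (y - x)) \<le> e * norm (y - x)"
      using mp[OF spec[OF d] e] by metis
    have "norm (f (x + h) - f x - f' h) \<le> e * norm h" if "norm h < d" for h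
      using d[of "x + h"] that by simp
    with d0 show ?thesis by blast
  qed
  ultimately show ?thesis
    by (simp add: has_frechet_derivative_def type_space_def)
qed

text \<open>On the real line the seminorm is the absolute value, so a vanishing scaled remainder
  means that the difference quotients themselves converge.\<close>

lemma has_frechet_derivative_real_directional:
  fixes f :: "'a::real_vector \<Rightarrow> real"
  assumes X: "normed_space X" and f: "has_frechet_derivative X type_space D f f' x"
    and x: "x \<in> D" and h: "h \<in> pts X"
    and r: "\<And>n. 0 < r n" "r \<longlonglongrightarrow> 0" and D: "\<And>n. x + r n *\<^sub>R h \<in> D"
  shows "(\<lambda>n. (f (x + r n *\<^sub>R h) - f x) / r n) \<longlonglongrightarrow> f' h"
proof -
  have "\<bar>f (x + r n *\<^sub>R h) - f x - r n * f' h\<bar> / r n = \<bar>(f (x + r n *\<^sub>R h) - f x) / r n - f' h\<bar>" for n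
    using abs_div_pos[OF r(1)[of n], of "f (x + r n *\<^sub>R h) - f x - r n * f' h"] r(1)[of n]
    by (simp add: diff_divide_distrib)
  moreover have "(\<lambda>n. \<bar>f (x + r n *\<^sub>R h) - f x - r n * f' h\<bar> / r n) \<longlonglongrightarrow> 0"
    using has_frechet_derivative_directional[OF X normed_space_type_space f x h r D]
    by (simp add: type_space_def)
  ultimately have "(\<lambda>n. \<bar>(f (x + r n *\<^sub>R h) - f x) / r n - f' h\<bar>) \<longlonglongrightarrow> 0" by simp
  then show ?thesis by (rule LIM_zero_cancel[OF tendsto_rabs_zero_cancel])
qed

section \<open>Differentiation of the integral term\<close>

lemma integrable_mult_AE_bounded:
  fixes f w :: "'a \<Rightarrow> real"
  assumes f: "integrable N f" and [measurable]: "w \<in> borel_measurable N" and w: "AE \<xi> in N. \<bar>w \<xi>\<bar> \<le> K"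
  shows "integrable N (\<lambda>\<xi>. f \<xi> * w \<xi>)"
proof (rule Bochner_Integration.integrable_bound)
  show "integrable N (\<lambda>\<xi>. K * f \<xi>)" using f by simp
  show "(\<lambda>\<xi>. f \<xi> * w \<xi>) \<in> borel_measurable N" using f by measurable
  show "AE \<xi> in N. norm (f \<xi> * w \<xi>) \<le> norm (K * f \<xi>)"
    using w
  proof eventually_elim
    case (elim \<xi>)
    then show ?case
      using mult_right_mono[of "\<bar>w \<xi>\<bar>" "\<bar>K\<bar>" "\<bar>f \<xi>\<bar>"] by (simp add: abs_mult mult.commute)
  qed
qed

context
  fixes \<zeta> :: "real \<Rightarrow> real" and \<delta> :: real
  assumes kernel: "smoothing_kernel \<zeta>" and \<delta>: "0 < \<delta>"
begin

lemmas [measurable] = smooth_plus_measurable[OF kernel \<delta>] smooth_step_measurable[OF kernel \<delta>]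

text \<open>The Lipschitz bound gives growth by at most \<bar>y\<bar> plus the value at 0, and
  constants are integrable because the measure is finite.\<close>

lemma smooth_plus_integrable:
  assumes "finite_measure N" and J: "integrable N J"
  shows "integrable N (\<lambda>\<xi>. smooth_plus \<zeta> \<delta> (J \<xi>))"
proof (rule Bochner_Integration.integrable_bound)
  interpret finite_measure N by fact
  show "integrable N (\<lambda>\<xi>. \<bar>J \<xi>\<bar> + \<bar>smooth_plus \<zeta> \<delta> 0\<bar>)" using J by simp
  show "(\<lambda>\<xi>. smooth_plus \<zeta> \<delta> (J \<xi>)) \<in> borel_measurable N" using J by measurable
  have "\<bar>smooth_plus \<zeta> \<delta> y\<bar> \<le> \<bar>y\<bar> + \<bar>smooth_plus \<zeta> \<delta> 0\<bar>" for y
    using smooth_plus_lipschitz[OF kernel \<delta>, of y 0] by linarith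
  then show "AE \<xi> in N. norm (smooth_plus \<zeta> \<delta> (J \<xi>)) \<le> norm (\<bar>J \<xi>\<bar> + \<bar>smooth_plus \<zeta> \<delta> 0\<bar>)"
    by simp
qed

text \<open>
  Since \<^const>\<open>smooth_plus\<close> is 1-Lipschitz, the perturbed argument may be replaced by its
  linearization \<open>J + r\<^sub>n d\<close>, for which dominated convergence applies with majorant \<open>K \<bar>d\<bar>\<close>.
\<close>

lemma smooth_plus_integral_directional:
  assumes N: "finite_measure N"
    and J: "integrable N J" and Jn: "\<And>n. integrable N (Jn n)" and d: "integrable N d"
    and w [measurable]: "w \<in> borel_measurable N" and K: "AE \<xi> in N. \<bar>w \<xi>\<bar> \<le> K"
    and r: "\<And>n. 0 < r n" "r \<longlonglongrightarrow> (0::real)"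
    and lin: "(\<lambda>n. (LINT \<xi>|N. \<bar>Jn n \<xi> - J \<xi> - r n * d \<xi>\<bar>) / r n) \<longlonglongrightarrow> 0"
  shows "(\<lambda>n. ((LINT \<xi>|N. smooth_plus \<zeta> \<delta> (Jn n \<xi>) * w \<xi>)
             - (LINT \<xi>|N. smooth_plus \<zeta> \<delta> (J \<xi>) * w \<xi>)) / r n)
         \<longlonglongrightarrow> (LINT \<xi>|N. w \<xi> * smooth_step \<zeta> \<delta> (J \<xi>) * d \<xi>)"
proof -
  let ?p = "smooth_plus \<zeta> \<delta>" and ?s = "smooth_step \<zeta> \<delta>"
  let ?D = "\<lambda>n \<xi>. (?p (J \<xi> + r n * d \<xi>) - ?p (J \<xi>)) / r n * w \<xi>"
  note lip = smooth_plus_lipschitz[OF kernel \<delta>]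
  have [measurable]: "J \<in> borel_measurable N" "d \<in> borel_measurable N" using J d by auto
  have pint: "integrable N (\<lambda>\<xi>. ?p (F \<xi>) * w \<xi>)" if "integrable N F" for F
    by (intro integrable_mult_AE_bounded[OF _ w K] smooth_plus_integrable[OF N that])
  have intL: "integrable N (\<lambda>\<xi>. J \<xi> + r n * d \<xi>)" for n using J d by simp
  have lim: "(\<lambda>n. LINT \<xi>|N. ?D n \<xi>) \<longlonglongrightarrow> (LINT \<xi>|N. w \<xi> * ?s (J \<xi>) * d \<xi>)"
  proof (rule integral_dominated_convergence)
    show "integrable N (\<lambda>\<xi>. \<bar>d \<xi>\<bar> * \<bar>w \<xi>\<bar>)"
      using K d by (intro integrable_mult_AE_bounded[where K=K]) auto
    show "AE \<xi> in N. (\<lambda>n. ?D n \<xi>) \<longlonglongrightarrow> w \<xi> * ?s (J \<xi>) * d \<xi>"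
    proof (rule AE_I2)
      fix \<xi>
      \<comment> \<open>For fixed \<xi> the limit is the one-dimensional chain rule along the line
        with slope \<open>d \<xi>\<close>.\<close>
      have "((\<lambda>h. ?p (J \<xi> + h * d \<xi>)) has_real_derivative ?s (J \<xi>) * d \<xi>) (at 0)"
        by (rule DERIV_chain2[where g="\<lambda>h. J \<xi> + h * d \<xi>"])
          (auto intro!: derivative_eq_intros smooth_plus_has_derivative[OF kernel \<delta>])
      then have "((\<lambda>h. (?p (J \<xi> + h * d \<xi>) - ?p (J \<xi>)) / h) \<longlongrightarrow> ?s (J \<xi>) * d \<xi>) (at 0)"
        by (simp add: has_field_derivative_iff)
      moreover have "filterlim r (at 0) sequentially"
        using r by (auto simp: filterlim_at less_imp_neq[symmetric])
      ultimately have "(\<lambda>n. (?p (J \<xi> + r n * d \<xi>) - ?p (J \<xi>)) / r n) \<longlonglongrightarrow> ?s (J \<xi>) * d \<xi>"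
        by (rule filterlim_compose)
      from tendsto_mult_right[OF this, of "w \<xi>"]
      show "(\<lambda>n. ?D n \<xi>) \<longlonglongrightarrow> w \<xi> * ?s (J \<xi>) * d \<xi>" by (simp add: mult_ac)
    qed
    show "AE \<xi> in N. norm (?D n \<xi>) \<le> \<bar>d \<xi>\<bar> * \<bar>w \<xi>\<bar>" for n
    proof (rule AE_I2)
      fix \<xi>
      have "\<bar>?p (J \<xi> + r n * d \<xi>) - ?p (J \<xi>)\<bar> \<le> r n * \<bar>d \<xi>\<bar>"
        using lip[of "J \<xi> + r n * d \<xi>" "J \<xi>"] r(1)[of n] by (simp add: abs_mult)
      then have "\<bar>(?p (J \<xi> + r n * d \<xi>) - ?p (J \<xi>)) / r n\<bar> \<le> \<bar>d \<xi>\<bar>"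
        using r(1)[of n] by (simp add: divide_le_eq mult.commute)
      then show "norm (?D n \<xi>) \<le> \<bar>d \<xi>\<bar> * \<bar>w \<xi>\<bar>"
        unfolding real_norm_def abs_mult by (rule mult_right_mono) simp
    qed
  qed measurable
  \<comment> \<open>Passing from \<open>Jn n\<close> to its linearization changes the quotient by at
    most \<bar>K\<bar> times the scaled L1 remainder, which tends to 0 by \<open>lin\<close>. The
    absolute value is taken because an almost everywhere bound \<open>K\<close> may be negative when
    the measure is zero.\<close>
  have "(\<lambda>n. ((LINT \<xi>|N. ?p (Jn n \<xi>) * w \<xi>) - (LINT \<xi>|N. ?p (J \<xi>) * w \<xi>)) / r n - (LINT \<xi>|N. ?D n \<xi>))
      \<longlonglongrightarrow> 0"
  proof (rule Lim_null_comparison)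
    show "(\<lambda>n. \<bar>K\<bar> * ((LINT \<xi>|N. \<bar>Jn n \<xi> - J \<xi> - r n * d \<xi>\<bar>) / r n)) \<longlonglongrightarrow> 0"
      using tendsto_mult_right_zero[OF lin, of "\<bar>K\<bar>"] .
    show "\<forall>\<^sub>F n in sequentially. norm (((LINT \<xi>|N. ?p (Jn n \<xi>) * w \<xi>) - (LINT \<xi>|N. ?p (J \<xi>) * w \<xi>)) / r n
        - (LINT \<xi>|N. ?D n \<xi>)) \<le> \<bar>K\<bar> * ((LINT \<xi>|N. \<bar>Jn n \<xi> - J \<xi> - r n * d \<xi>\<bar>) / r n)"
    proof (rule always_eventually, rule allI)
      fix n
      let ?E = "\<lambda>\<xi>. ?p (Jn n \<xi>) * w \<xi> - ?p (J \<xi> + r n * d \<xi>) * w \<xi>"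
      have "(LINT \<xi>|N. ?D n \<xi>) = (LINT \<xi>|N. (?p (J \<xi> + r n * d \<xi>) * w \<xi> - ?p (J \<xi>) * w \<xi>) / r n)"
        by (intro Bochner_Integration.integral_cong) (auto simp: algebra_simps diff_divide_distrib)
      also have "\<dots> = ((LINT \<xi>|N. ?p (J \<xi> + r n * d \<xi>) * w \<xi>) - (LINT \<xi>|N. ?p (J \<xi>) * w \<xi>)) / r n"
        using pint[OF intL] pint[OF J] by simp
      finally have "((LINT \<xi>|N. ?p (Jn n \<xi>) * w \<xi>) - (LINT \<xi>|N. ?p (J \<xi>) * w \<xi>)) / r n - (LINT \<xi>|N. ?D n \<xi>)
          = (LINT \<xi>|N. ?E \<xi>) / r n"
        using pint[OF intL, of n] pint[OF Jn, of n] by (simp add: diff_divide_distrib)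
      then have eq: "norm (((LINT \<xi>|N. ?p (Jn n \<xi>) * w \<xi>) - (LINT \<xi>|N. ?p (J \<xi>) * w \<xi>)) / r n - (LINT \<xi>|N. ?D n \<xi>))
          = \<bar>LINT \<xi>|N. ?E \<xi>\<bar> / r n"
        using r(1)[of n] by simp
      have "\<bar>LINT \<xi>|N. ?E \<xi>\<bar> \<le> (LINT \<xi>|N. \<bar>?E \<xi>\<bar>)"
        using integral_norm_bound[of N ?E] by simp
      also have "\<dots> \<le> (LINT \<xi>|N. \<bar>K\<bar> * \<bar>Jn n \<xi> - J \<xi> - r n * d \<xi>\<bar>)"
      proof (rule integral_mono_AE)
        show "integrable N (\<lambda>\<xi>. \<bar>?E \<xi>\<bar>)"
          using pint[OF intL, of n] pint[OF Jn, of n] by simp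
        show "integrable N (\<lambda>\<xi>. \<bar>K\<bar> * \<bar>Jn n \<xi> - J \<xi> - r n * d \<xi>\<bar>)"
          using J Jn d by simp
        show "AE \<xi> in N. \<bar>?E \<xi>\<bar> \<le> \<bar>K\<bar> * \<bar>Jn n \<xi> - J \<xi> - r n * d \<xi>\<bar>"
          using K
        proof eventually_elim
          case (elim \<xi>)
          have "\<bar>?E \<xi>\<bar> = \<bar>w \<xi>\<bar> * \<bar>?p (Jn n \<xi>) - ?p (J \<xi> + r n * d \<xi>)\<bar>"
            by (simp add: abs_mult[symmetric] algebra_simps)
          also have "\<dots> \<le> \<bar>K\<bar> * \<bar>Jn n \<xi> - (J \<xi> + r n * d \<xi>)\<bar>"
            using elim by (intro mult_mono lip) auto
          finally show ?case by (simp add: diff_diff_eq)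
        qed
      qed
      also have "\<dots> = \<bar>K\<bar> * (LINT \<xi>|N. \<bar>Jn n \<xi> - J \<xi> - r n * d \<xi>\<bar>)" by simp
      finally show "norm (((LINT \<xi>|N. ?p (Jn n \<xi>) * w \<xi>) - (LINT \<xi>|N. ?p (J \<xi>) * w \<xi>)) / r n
          - (LINT \<xi>|N. ?D n \<xi>)) \<le> \<bar>K\<bar> * ((LINT \<xi>|N. \<bar>Jn n \<xi> - J \<xi> - r n * d \<xi>\<bar>) / r n)"
        unfolding eq times_divide_eq_right using r(1)[of n] by (intro divide_right_mono) auto
    qed
  qed
  from tendsto_add[OF this lim] show ?thesis by simp
qed

text \<open>This is the common core of the conditions in \<open>z\<close> and in \<open>tt\<close>:
  \<open>X\<close> is \<open>type_space\<close> with the open set \<open>V\<close> as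
  \<open>D\<close>, or \<open>TT\<close> with its whole carrier, and the exponent is
  \<open>q'\<close> of the theorem. The embedding bound for \<open>S\<close> turns the scaled
  remainder of \<open>G\<close> in the Lebesgue norm into a scaled L1 remainder.\<close>

lemma smooth_plus_integral_frechet_directional:
  fixes X :: "'a::real_vector nspace" and G :: "'a \<Rightarrow> 'x \<Rightarrow> real"
  assumes X: "normed_space X" and q: "1 \<le> q"
    and G: "has_frechet_derivative X (Lp M (ennreal q)) D G G' x" and x: "x \<in> D" and h: "h \<in> pts X"
    and r: "\<And>n. 0 < r n" "r \<longlonglongrightarrow> 0" and D: "\<And>n. x + r n *\<^sub>R h \<in> D"
    and S: "S \<in> sets M" "emeasure M S < \<infinity>"
    and w: "w \<in> borel_measurable M" and K: "AE \<xi> in M. \<bar>w \<xi>\<bar> \<le> K"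
  shows "(\<lambda>n. ((LINT \<xi>|restrict_space M S. smooth_plus \<zeta> \<delta> (G (x + r n *\<^sub>R h) \<xi> - \<gamma>) * w \<xi>)
             - (LINT \<xi>|restrict_space M S. smooth_plus \<zeta> \<delta> (G x \<xi> - \<gamma>) * w \<xi>)) / r n)
         \<longlonglongrightarrow> (LINT \<xi>|restrict_space M S. w \<xi> * smooth_step \<zeta> \<delta> (G x \<xi> - \<gamma>) * G' h \<xi>)"
proof -
  let ?N = "restrict_space M S" and ?L = "Lp M (ennreal q) :: ('x \<Rightarrow> real) nspace"
  have N: "finite_measure ?N"
    using S by (intro finite_measureI) (simp add: emeasure_restrict_space space_restrict_space)
  interpret finite_measure ?N by fact
  have L: "normed_space ?L" using q by (intro normed_space_Lp) simp
  have GL: "\<And>y. y \<in> D \<Longrightarrow> G y \<in> pts ?L" and G'L: "G' h \<in> pts ?L"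
    using G h by (auto simp: has_frechet_derivative_def bounded_linear_map_def)
  note int = Lp_finite_integrable_on_finite_measure(1)[OF q _ S]
  note bound = Lp_finite_integrable_on_finite_measure(2)[OF q _ S]
  let ?R = "\<lambda>n. G (x + r n *\<^sub>R h) - G x - r n *\<^sub>R G' h"
  have R: "?R n \<in> pts ?L" for n
    by (intro pts_diff[OF L] pts_scaleR[OF L] GL G'L x D)
  show ?thesis
  proof (rule smooth_plus_integral_directional[OF N _ _ _ _ _ r])
    show "integrable ?N (\<lambda>\<xi>. G x \<xi> - \<gamma>)" "\<And>n. integrable ?N (\<lambda>\<xi>. G (x + r n *\<^sub>R h) \<xi> - \<gamma>)"
      using int[OF GL[OF x]] int[OF GL[OF D]] by auto
    show "integrable ?N (G' h)" using int[OF G'L] .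
    show "w \<in> borel_measurable ?N" using w by (rule measurable_restrict_space1)
    show "AE \<xi> in ?N. \<bar>w \<xi>\<bar> \<le> K" using K S(1) by (subst AE_restrict_space_iff) (auto elim: eventually_mono)
    show "(\<lambda>n. (LINT \<xi>|?N. \<bar>G (x + r n *\<^sub>R h) \<xi> - \<gamma> - (G x \<xi> - \<gamma>) - r n * G' h \<xi>\<bar>) / r n) \<longlonglongrightarrow> 0"
    proof (rule Lim_null_comparison)
      show "(\<lambda>n. (measure M S + 1) * (snorm ?L (?R n) / r n)) \<longlonglongrightarrow> 0"
        by (intro tendsto_mult_right_zero has_frechet_derivative_directional[OF X L G x h r D])
      have "(LINT \<xi>|?N. \<bar>G (x + r n *\<^sub>R h) \<xi> - \<gamma> - (G x \<xi> - \<gamma>) - r n * G' h \<xi>\<bar>)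
          \<le> (measure M S + 1) * snorm ?L (?R n)" for n
        using bound[OF R, of n] by (simp add: scaleR_fun_def)
      then have "(LINT \<xi>|?N. \<bar>G (x + r n *\<^sub>R h) \<xi> - \<gamma> - (G x \<xi> - \<gamma>) - r n * G' h \<xi>\<bar>) / r n
          \<le> (measure M S + 1) * (snorm ?L (?R n) / r n)" for n
        unfolding times_divide_eq_right using r(1)[of n] by (intro divide_right_mono) auto
      moreover have "0 \<le> (LINT \<xi>|?N. \<bar>G (x + r n *\<^sub>R h) \<xi> - \<gamma> - (G x \<xi> - \<gamma>) - r n * G' h \<xi>\<bar>) / r n" for n
        using r(1)[of n] by (intro divide_nonneg_pos Bochner_Integration.integral_nonneg) auto
      ultimately show "\<forall>\<^sub>F n in sequentially.
          norm ((LINT \<xi>|?N. \<bar>G (x + r n *\<^sub>R h) \<xi> - \<gamma> - (G x \<xi> - \<gamma>) - r n * G' h \<xi>\<bar>) / r n)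
          \<le> (measure M S + 1) * (snorm ?L (?R n) / r n)"
        by (simp only: real_norm_def abs_of_nonneg eventually_True)
    qed
  qed
qed

end

section \<open>Convexity of the constraint sets\<close>

lemma convex_pts: "normed_space X \<Longrightarrow> convex (pts X)"
  by (simp add: normed_space_def subspace_imp_convex)

lemma convex_densities: "convex (densities M)"
proof (rule convexI)
  fix f g :: "'a \<Rightarrow> real" and u v :: real
  assume f: "f \<in> densities M" and g: "g \<in> densities M" and uv: "0 \<le> u" "0 \<le> v" "u + v = 1"
  \<comment> \<open>A function that is not integrable has integral 0, so the normalization to 1
    certifies the integrability on which linearity of the integral rests.\<close>
  have int: "integrable M f" "integrable M g"
    using f g not_integrable_integral_eq[of M f] not_integrable_integral_eq[of M g]
    by (auto simp: densities_def)
  have "normed_space (Lp M \<infinity> :: ('a \<Rightarrow> real) nspace)" by (rule normed_space_Lp) simp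
  then have "u *\<^sub>R f + v *\<^sub>R g \<in> pts (Lp M \<infinity>)"
    using f g by (simp add: densities_def pts_add pts_scaleR)
  moreover have "AE \<xi> in M. 0 \<le> f \<xi>" "AE \<xi> in M. 0 \<le> g \<xi>"
    using f g by (auto simp: densities_def)
  then have "AE \<xi> in M. 0 \<le> (u *\<^sub>R f + v *\<^sub>R g) \<xi>"
    by eventually_elim (use uv in \<open>simp add: scaleR_fun_def\<close>)
  moreover have "(LINT \<xi>|M. (u *\<^sub>R f + v *\<^sub>R g) \<xi>) = 1"
    using f g uv int by (simp add: densities_def scaleR_fun_def)
  ultimately show "u *\<^sub>R f + v *\<^sub>R g \<in> densities M" by (simp add: densities_def del: plus_fun_apply)
qed

text \<open>The representation on \<open>S\<close> is linear in its data: \<open>w\<close> and the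
  coefficient of \<rho> combine with the same weights \<open>u\<close> and \<open>v\<close>, off one
  common null set.\<close>

lemma convex_pert_scalar:
  assumes W: "normed_space W" and q: "1 \<le> q"
  shows "convex (pert_scalar M q S W \<rho>)"
proof (rule convexI)
  fix t t' :: "'a \<Rightarrow> real" and u v :: real
  assume t: "t \<in> pert_scalar M q S W \<rho>" and t': "t' \<in> pert_scalar M q S W \<rho>"
    and uv: "0 \<le> u" "0 \<le> v" "u + v = 1"
  from t t' obtain w a w' a' where w: "w \<in> pts W" "AE \<xi> in M. \<xi> \<in> S \<longrightarrow> t \<xi> = w \<xi> + a * \<rho> \<xi>"
    and w': "w' \<in> pts W" "AE \<xi> in M. \<xi> \<in> S \<longrightarrow> t' \<xi> = w' \<xi> + a' * \<rho> \<xi>"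
    unfolding pert_scalar_def by auto
  from w(2) w'(2)
  have "AE \<xi> in M. \<xi> \<in> S \<longrightarrow> (u *\<^sub>R t + v *\<^sub>R t') \<xi> = (u *\<^sub>R w + v *\<^sub>R w') \<xi> + (u * a + v * a') * \<rho> \<xi>"
    by eventually_elim (simp add: scaleR_fun_def algebra_simps)
  moreover have "u *\<^sub>R w + v *\<^sub>R w' \<in> pts W"
    by (intro pts_add[OF W] pts_scaleR[OF W] w w')
  \<comment> \<open>\<open>N\<close> is left open because membership is needed both for
    \<open>M\<close> and for its restriction to the complement of \<open>S\<close>.\<close>
  moreover have "u *\<^sub>R t + v *\<^sub>R t' \<in> pts (Lp N (ennreal q))"
    if "t \<in> pts (Lp N (ennreal q))" "t' \<in> pts (Lp N (ennreal q))" for N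
    using that uv q by (intro convexD[OF convex_pts[OF normed_space_Lp]]) auto
  ultimately show "u *\<^sub>R t + v *\<^sub>R t' \<in> pert_scalar M q S W \<rho>"
    using t t' unfolding pert_scalar_def by blast
qed

lemma convex_pert_vector:
  assumes W: "normed_space W" and q: "1 \<le> q"
  shows "convex (pert_vector M q S W \<eta>)"
proof (rule convexI)
  fix t t' :: "'a \<Rightarrow> 'a" and u v :: real
  assume t: "t \<in> pert_vector M q S W \<eta>" and t': "t' \<in> pert_vector M q S W \<eta>"
    and uv: "0 \<le> u" "0 \<le> v" "u + v = 1"
  from t t' obtain w a b w' a' b' where
    w: "w \<in> pts W" "AE \<xi> in M. \<xi> \<in> S \<longrightarrow> t \<xi> = w \<xi> + a *\<^sub>R \<xi> + b *\<^sub>R \<eta> \<xi>"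
    and w': "w' \<in> pts W" "AE \<xi> in M. \<xi> \<in> S \<longrightarrow> t' \<xi> = w' \<xi> + a' *\<^sub>R \<xi> + b' *\<^sub>R \<eta> \<xi>"
    unfolding pert_vector_def by auto
  from w(2) w'(2)
  have "AE \<xi> in M. \<xi> \<in> S \<longrightarrow> (u *\<^sub>R t + v *\<^sub>R t') \<xi>
      = (u *\<^sub>R w + v *\<^sub>R w') \<xi> + (u * a + v * a') *\<^sub>R \<xi> + (u * b + v * b') *\<^sub>R \<eta> \<xi>"
    by eventually_elim (simp add: scaleR_fun_def algebra_simps)
  moreover have "u *\<^sub>R w + v *\<^sub>R w' \<in> pts W"
    by (intro pts_add[OF W] pts_scaleR[OF W] w w')
  moreover have "u *\<^sub>R t + v *\<^sub>R t' \<in> pts (Lp N (ennreal q))"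
    if "t \<in> pts (Lp N (ennreal q))" "t' \<in> pts (Lp N (ennreal q))" for N
    using that uv q by (intro convexD[OF convex_pts[OF normed_space_Lp]]) auto
  ultimately show "u *\<^sub>R t + v *\<^sub>R t' \<in> pert_vector M q S W \<eta>"
    using t t' unfolding pert_vector_def by blast
qed

section \<open>First-order optimality conditions\<close>

lemma densities_measurable_bounded:
  assumes "f \<in> densities M"
  shows "f \<in> borel_measurable M" "\<exists>K. AE \<xi> in M. \<bar>f \<xi>\<bar> \<le> K"
  using assms strongly_measurable_imp_borel_measurable[of M f] by (auto simp: densities_def Lp_def)

lemma set_integral_eq_restrict_space:
  fixes f :: "'a \<Rightarrow> real"
  assumes "S \<in> sets M"
  shows "(LINT \<xi>:S|M. f \<xi>) = (LINT \<xi>|restrict_space M S. f \<xi>)"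
  using assms by (simp add: set_lebesgue_integral_def integral_restrict_space)

lemma convex_segment:
  assumes "convex S" "a \<in> S" "b \<in> S" "0 \<le> u" "u \<le> 1"
  shows "a + u *\<^sub>R (b - a) \<in> S"
  using convexD_alt[OF assms] by (simp add: algebra_simps)

lemma limit_nonneg:
  fixes f :: "nat \<Rightarrow> real"
  assumes "f \<longlonglongrightarrow> l" "\<And>n. 0 \<le> f n"
  shows "0 \<le> l"
  using assms by (intro LIMSEQ_le_const) auto

theorem theorem4p2:
  fixes M P :: "'x::real_normed_vector measure"
    and Z_ad V :: "'z::banach set"
    and f\<^sub>0 :: "'z \<Rightarrow> ereal"
    and g :: "'u::banach \<Rightarrow> ereal"
    and s :: "'x \<Rightarrow> 'z \<Rightarrow> 'u"
    and \<beta> \<kappa> q q' \<epsilon> \<delta> :: real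
    and p :: ennreal
    and \<zeta> :: "real \<Rightarrow> real"
    and \<Xi>t :: "real \<Rightarrow> 'x set" and C :: "nat \<Rightarrow> 'x set" and \<Xi> :: "real \<Rightarrow> 'x set"
    and \<rho> :: "real \<Rightarrow> 'x \<Rightarrow> real" and \<eta> :: "real \<Rightarrow> 'x \<Rightarrow> 'x"
    and W :: "real \<Rightarrow> ('x \<Rightarrow> real) nspace" and WW :: "real \<Rightarrow> ('x \<Rightarrow> 'x) nspace"
    and T :: "('x \<Rightarrow> real) nspace" and TT :: "('x \<Rightarrow> 'x) nspace"
    and A :: "('x \<Rightarrow> real) set" and B :: "('x \<Rightarrow> 'x) set"
    and H :: "('x \<Rightarrow> real) \<times> ('x \<Rightarrow> 'x) \<Rightarrow> real"
    and \<theta> :: "real \<Rightarrow> real"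
    and \<phi> :: "real \<Rightarrow> real"
    and DtH :: "('x \<Rightarrow> real) \<times> ('x \<Rightarrow> 'x) \<Rightarrow> ('x \<Rightarrow> real) \<Rightarrow> real"
    and DttH :: "('x \<Rightarrow> real) \<times> ('x \<Rightarrow> 'x) \<Rightarrow> ('x \<Rightarrow> 'x) \<Rightarrow> real"
    and Df\<^sub>0 :: "'z \<Rightarrow> 'z \<Rightarrow> real"
    and Dtts :: "('x \<Rightarrow> 'x) \<Rightarrow> 'z \<Rightarrow> ('x \<Rightarrow> 'x) \<Rightarrow> ('x \<Rightarrow> 'u)"
    and Dzs :: "('x \<Rightarrow> 'x) \<Rightarrow> 'z \<Rightarrow> 'z \<Rightarrow> ('x \<Rightarrow> 'u)"
    and Dg :: "('x \<Rightarrow> 'u) \<Rightarrow> ('x \<Rightarrow> 'u) \<Rightarrow> ('x \<Rightarrow> real)"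
    and z\<^sub>s :: 'z and \<gamma>\<^sub>s :: real and t\<^sub>s :: "'x \<Rightarrow> real" and tt\<^sub>s :: "'x \<Rightarrow> 'x"
    and \<omega>\<^sub>s :: "'x \<Rightarrow> 'x" and u\<^sub>s :: "'x \<Rightarrow> 'u" and J\<^sub>s :: "'x \<Rightarrow> real"
  \<comment> \<open>spaces, measures and exponents\<close>
  assumes "reflexive_space (type_space :: 'z nspace)"
    and "prob_space P" and "space M = UNIV" and "sets P = sets M"
    and "sigma_finite_measure M" and "absolutely_continuous M P"
    and "1 < q" and "1 < q'" and "1 / q + 1 / q' = 1"
    and "T = Lp M (ennreal q)" and "TT = Lp M (ennreal q')"
    and "0 < \<beta>" and "\<beta> < 1" and "\<kappa> = 1 / (1 - \<beta>)"
  \<comment> \<open>problem data\<close>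
    and "Z_ad \<noteq> {}" and "closed Z_ad" and "convex Z_ad"
    and "\<forall>z. (\<lambda>\<xi>. s \<xi> z) \<in> borel_measurable M"
    and "\<forall>xs x zs z. xs \<longlonglongrightarrow> x \<and> weakly_tendsto type_space zs z
           \<longrightarrow> weakly_tendsto type_space (\<lambda>n. s (xs n) (zs n)) (s x z)"
    and "proper f\<^sub>0" and "seq_weakly_lsc type_space f\<^sub>0" and "seq_weakly_lsc type_space g"
    and "\<forall>r\<ge>0. 0 \<le> \<phi> r"
    and "\<forall>\<xi> z. \<bar>g (s \<xi> z)\<bar> \<le> ereal (\<phi> (norm z) * norm \<xi>)"
    and "smoothing_kernel \<zeta>"
  \<comment> \<open>subdomains\<close>
    and "\<forall>e>0. \<Xi>t e \<in> sets M"
    and "AE \<xi> in M. ((\<lambda>e. indicator (\<Xi>t e) \<xi> :: real) \<longlongrightarrow> 1) (at_right 0)"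
    and "incseq C" and "\<forall>n. C n \<in> sets M" and "(\<Union>n. C n) = UNIV"
    and "\<forall>n. emeasure M (C n) < \<infinity>"
    and "\<Xi> = subdomain \<Xi>t C"
  \<comment> \<open>corruptions and perturbation spaces\<close>
    and "\<forall>e>0. \<rho> e \<in> densities M \<and> supported_in M (\<Xi> e) (\<rho> e)"
    and "\<forall>e>0. \<eta> e \<in> pts TT \<and> supported_in M (\<Xi> e) (\<eta> e)"
    and "\<forall>e>0. banach_space (W e) \<and> reflexive_space (W e) \<and>
           compactly_embedded (W e) (Lp (restrict_space M (\<Xi> e)) (ennreal q))"
    and "\<forall>e>0. banach_space (WW e) \<and> reflexive_space (WW e) \<and>
           compactly_embedded (WW e) (Lp (restrict_space M (\<Xi> e)) (ennreal q'))"
  \<comment> \<open>penalty\<close>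
    and "weakly_lsc (prod_space T TT) H" and "coercive (prod_space T TT) (\<lambda>x. ereal (H x))"
    and "H (0, 0) = 0"
    and "\<forall>x. range x \<subseteq> pts (prod_space T TT) \<and> (\<lambda>k. H (x k)) \<longlonglongrightarrow> 0
           \<longrightarrow> norm_tendsto (prod_space T TT) x (0, 0)"
    and "\<forall>e>0. 0 < \<theta> e" and "filterlim \<theta> at_top (at_right 0)"
    and "0 < \<epsilon>" and "0 < \<delta>"
  \<comment> \<open>differentiability assumptions (a)--(f)\<close>
    and "\<forall>x\<in>pts (prod_space T TT).
           \<exists>D. has_frechet_derivative (prod_space T TT) type_space (pts (prod_space T TT)) H D x"
    and "\<forall>t\<in>pts T. \<forall>tt\<in>pts TT.
           has_frechet_derivative T type_space (pts T) (\<lambda>y. H (y, tt)) (DtH (t, tt)) t"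
    and "\<forall>t\<in>pts T. \<forall>tt\<in>pts TT.
           has_frechet_derivative TT type_space (pts TT) (\<lambda>y. H (t, y)) (DttH (t, tt)) tt"
    and "1 \<le> p"
    and "\<forall>tt\<in>pts TT. \<forall>z\<in>Z_ad. (\<lambda>\<xi>. s (\<eta> \<epsilon> \<xi> + tt \<xi>) z) \<in> pts (Lp M p)"
    and "open V" and "Z_ad \<subseteq> V"
    and "\<forall>z\<in>V. \<bar>f\<^sub>0 z\<bar> \<noteq> \<infinity> \<and> ((\<lambda>y. real_of_ereal (f\<^sub>0 y)) has_derivative Df\<^sub>0 z) (at z)"
    and "\<forall>z\<in>Z_ad. \<forall>tt\<in>pts TT.
           has_frechet_derivative TT (Lp M p) (pts TT) (\<lambda>y \<xi>. s (y \<xi>) z) (Dtts tt z) tt"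
    and "\<forall>tt\<in>pts TT. \<forall>z\<in>V.
           has_frechet_derivative type_space (Lp M p) V (\<lambda>y \<xi>. s (tt \<xi>) y) (Dzs tt z) z"
    and "\<forall>u\<in>pts (Lp M p :: ('x \<Rightarrow> 'u) nspace). AE \<xi> in M. \<bar>g (u \<xi>)\<bar> \<noteq> \<infinity>"
    and "\<forall>u\<in>pts (Lp M p). has_frechet_derivative (Lp M p) (Lp M (ennreal q')) (pts (Lp M p))
           (\<lambda>y \<xi>. real_of_ereal (g (y \<xi>))) (Dg u) u"
  \<comment> \<open>the minimizer\<close>
    and "coercive type_space f\<^sub>0 \<or> bounded Z_ad"
    and "A = {t \<in> pert_scalar M q (\<Xi> \<epsilon>) (W \<epsilon>) (\<rho> \<epsilon>). \<rho> \<epsilon> + t \<in> densities M}"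
    and "B = pert_vector M q' (\<Xi> \<epsilon>) (WW \<epsilon>) (\<eta> \<epsilon>)"
    and "z\<^sub>s \<in> Z_ad" and "t\<^sub>s \<in> A" and "tt\<^sub>s \<in> B"
    and "\<forall>z\<in>Z_ad. \<forall>\<gamma>. \<forall>t\<in>pts T. \<forall>tt\<in>pts TT.
           Phi M f\<^sub>0 g s H \<kappa> \<zeta> \<delta> (\<Xi> \<epsilon>) (\<rho> \<epsilon>) (\<eta> \<epsilon>) (\<theta> \<epsilon>) A B z\<^sub>s \<gamma>\<^sub>s t\<^sub>s tt\<^sub>s
           \<le> Phi M f\<^sub>0 g s H \<kappa> \<zeta> \<delta> (\<Xi> \<epsilon>) (\<rho> \<epsilon>) (\<eta> \<epsilon>) (\<theta> \<epsilon>) A B z \<gamma> t tt"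
    and "\<omega>\<^sub>s = \<eta> \<epsilon> + tt\<^sub>s"
    and "u\<^sub>s = (\<lambda>\<xi>. s (\<omega>\<^sub>s \<xi>) z\<^sub>s)"
    and "J\<^sub>s = (\<lambda>\<xi>. real_of_ereal (g (u\<^sub>s \<xi>)) - \<gamma>\<^sub>s)"
  shows "(\<forall>z\<in>Z_ad. Df\<^sub>0 z\<^sub>s (z - z\<^sub>s)
            + \<kappa> * (LINT \<xi>:\<Xi> \<epsilon>|M. (\<rho> \<epsilon> \<xi> + t\<^sub>s \<xi>) * smooth_step \<zeta> \<delta> (J\<^sub>s \<xi>)
                * Dg u\<^sub>s (Dzs \<omega>\<^sub>s z\<^sub>s (z - z\<^sub>s)) \<xi>) \<ge> 0)
       \<and> (LINT \<xi>:\<Xi> \<epsilon>|M. (\<rho> \<epsilon> \<xi> + t\<^sub>s \<xi>) * smooth_step \<zeta> \<delta> (J\<^sub>s \<xi>)) = 1 / \<kappa>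
       \<and> (\<forall>t\<in>A. \<theta> \<epsilon> * DtH (t\<^sub>s, tt\<^sub>s) (t - t\<^sub>s)
            + \<kappa> * (LINT \<xi>:\<Xi> \<epsilon>|M. smooth_plus \<zeta> \<delta> (J\<^sub>s \<xi>) * (t \<xi> - t\<^sub>s \<xi>)) \<ge> 0)
       \<and> (\<forall>tt\<in>B. \<theta> \<epsilon> * DttH (t\<^sub>s, tt\<^sub>s) (tt - tt\<^sub>s)
            + \<kappa> * (LINT \<xi>:\<Xi> \<epsilon>|M. (\<rho> \<epsilon> \<xi> + t\<^sub>s \<xi>) * smooth_step \<zeta> \<delta> (J\<^sub>s \<xi>)
                * Dg u\<^sub>s (Dtts \<omega>\<^sub>s z\<^sub>s (tt - tt\<^sub>s)) \<xi>) \<ge> 0)"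
proof -
  note q = assms(7) and q' = assms(8) and T = assms(10) and TT = assms(11)
    and kernel = assms(25) and \<epsilon> = assms(43) and \<delta> = assms(44)
    and dH1 = assms(46) and dH2 = assms(47) and p = assms(48)
    and VZ = assms(51) and df = assms(52) and dtts = assms(53) and dzs = assms(54) and dg = assms(56)
    and A = assms(58) and B = assms(59) and zs = assms(60) and ts = assms(61) and tts = assms(62)
    and minimal = assms(63) and \<omega> = assms(64) and u = assms(65) and J = assms(66)
  have \<kappa>: "0 < \<kappa>" using assms(12-14) by simp
  define S where "S = \<Xi> \<epsilon>"
  define N where "N = restrict_space M S"
  \<comment> \<open>The perturbed density lies in \<open>densities M\<close> because
    \<open>t\<^sub>s \<in> A\<close>; hence it is essentially bounded.\<close>
  define w where "w = \<rho> \<epsilon> + t\<^sub>s"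
  define r where "r n = inverse (real (Suc n))" for n
  define F where "F z = real_of_ereal (f\<^sub>0 z)" for z
  define G where "G y z = (\<lambda>\<xi>. real_of_ereal (g (s (y \<xi>) z)))" for y :: "'x \<Rightarrow> 'x" and z
  \<comment> \<open>The integral term depends on an inner argument and a density: the conditions in
    \<open>z\<close>, \<open>\<gamma>\<close> and \<open>tt\<close> vary only the former, the
    condition in \<open>t\<close> only the latter.\<close>
  define I where "I J v = (LINT \<xi>|N. smooth_plus \<zeta> \<delta> (J \<xi>) * v \<xi>)" for J v :: "'x \<Rightarrow> real"
  have r: "\<And>n. 0 < r n" "r \<longlonglongrightarrow> 0" and r1: "\<And>n. r n \<le> 1"
    using LIMSEQ_inverse_real_of_nat by (auto simp: r_def[abs_def] inverse_le_1_iff)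

  \<comment> \<open>The subdomain as a finite measure space\<close>
  have S: "S \<in> sets M" "emeasure M S < \<infinity>"
  proof -
    \<comment> \<open>Intersecting with a member of the cover, whose measure is finite, is what
      makes \<open>S\<close> finite.\<close>
    have "\<Xi>t \<epsilon> \<in> sets M" "C (nat \<lceil>1 / \<epsilon>\<rceil>) \<in> sets M" "emeasure M (C (nat \<lceil>1 / \<epsilon>\<rceil>)) < \<infinity>"
      using assms(26,29,31) \<epsilon> by auto
    moreover have "S = \<Xi>t \<epsilon> \<inter> C (nat \<lceil>1 / \<epsilon>\<rceil>)" by (simp add: S_def assms(32) subdomain_def)
    ultimately show "S \<in> sets M" "emeasure M S < \<infinity>"
      by (auto intro: le_less_trans[OF emeasure_mono])
  qed
  have N: "finite_measure N"
    unfolding N_def using S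
    by (intro finite_measureI) (simp add: emeasure_restrict_space space_restrict_space)
  have LINT: "(LINT \<xi>:\<Xi> \<epsilon>|M. f \<xi>) = (LINT \<xi>|N. f \<xi>)" for f :: "'x \<Rightarrow> real"
    unfolding N_def S_def[symmetric] by (rule set_integral_eq_restrict_space[OF S(1)])

  \<comment> \<open>Admissible perturbations, bounded densities and convexity of \<open>A\<close>
    and \<open>B\<close>\<close>
  have T_ns: "normed_space T" and TT_ns: "normed_space TT"
    and p_ns: "normed_space (Lp M p :: ('x \<Rightarrow> 'u) nspace)"
    and q'_ns: "normed_space (Lp M (ennreal q') :: ('x \<Rightarrow> real) nspace)"
    unfolding T TT using q q' p by (auto intro!: normed_space_Lp)
  have A_dens: "\<rho> \<epsilon> + t \<in> densities M" and AT: "t \<in> pts T" if "t \<in> A" for t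
    using that by (auto simp: A pert_scalar_def T)
  have BTT: "t \<in> pts TT" if "t \<in> B" for t
    using that by (auto simp: B pert_vector_def TT)
  have \<omega>T: "\<omega>\<^sub>s \<in> pts TT"
    unfolding \<omega> using assms(34) \<epsilon> BTT[OF tts] by (auto intro: pts_add[OF TT_ns])
  have dens_N: "integrable N (\<lambda>\<xi>. f \<xi> * v \<xi>)" if f: "integrable N f" and v: "v \<in> densities M" for f v
  proof -
    obtain K where "AE \<xi> in M. \<bar>v \<xi>\<bar> \<le> K" using densities_measurable_bounded(2)[OF v] by blast
    then have "AE \<xi> in N. \<bar>v \<xi>\<bar> \<le> K"
      unfolding N_def using S(1) by (subst AE_restrict_space_iff) (auto elim: eventually_mono)
    then show ?thesis
      using f densities_measurable_bounded(1)[OF v]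
      by (intro integrable_mult_AE_bounded) (auto simp: N_def intro: measurable_restrict_space1)
  qed
  note w_dens = A_dens[OF ts, folded w_def]
  obtain K where K: "AE \<xi> in M. \<bar>w \<xi>\<bar> \<le> K" using densities_measurable_bounded(2)[OF w_dens] by blast
  have wm: "w \<in> borel_measurable M" by (rule densities_measurable_bounded(1)[OF w_dens])
  have "convex (pert_scalar M q (\<Xi> \<epsilon>) (W \<epsilon>) (\<rho> \<epsilon>))"
    using assms(35) \<epsilon> q by (intro convex_pert_scalar) (auto simp: banach_space_def)
  \<comment> \<open>This set is a translate of the convex set of densities: weights with sum 1
    reproduce the shift \<open>\<rho> \<epsilon>\<close>.\<close>
  moreover have "convex {t. \<rho> \<epsilon> + t \<in> densities M}"
  proof (rule convexI)
    fix a b :: "'x \<Rightarrow> real" and v v' :: real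
    assume "a \<in> {t. \<rho> \<epsilon> + t \<in> densities M}" "b \<in> {t. \<rho> \<epsilon> + t \<in> densities M}"
      and v: "0 \<le> v" "0 \<le> v'" "v + v' = 1"
    then have "v *\<^sub>R (\<rho> \<epsilon> + a) + v' *\<^sub>R (\<rho> \<epsilon> + b) \<in> densities M"
      by (intro convexD[OF convex_densities]) auto
    also have "v *\<^sub>R (\<rho> \<epsilon> + a) + v' *\<^sub>R (\<rho> \<epsilon> + b) = (v + v') *\<^sub>R \<rho> \<epsilon> + (v *\<^sub>R a + v' *\<^sub>R b)"
      by (simp only: scaleR_add_right scaleR_add_left add_ac)
    finally show "v *\<^sub>R a + v' *\<^sub>R b \<in> {t. \<rho> \<epsilon> + t \<in> densities M}"
      by (simp only: mem_Collect_eq v scaleR_one)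
  qed
  ultimately have A_convex: "convex A"
    unfolding A Collect_conj_eq Collect_mem_eq by (rule convex_Int)
  have B_convex: "convex B"
    unfolding B using assms(36) \<epsilon> q' by (intro convex_pert_vector) (auto simp: banach_space_def)

  \<comment> \<open>The functional and its minimality in real numbers\<close>
  have Phi: "Phi M f\<^sub>0 g s H \<kappa> \<zeta> \<delta> (\<Xi> \<epsilon>) (\<rho> \<epsilon>) (\<eta> \<epsilon>) (\<theta> \<epsilon>) A B z \<gamma> t tt
      = ereal (F z + \<gamma> + \<kappa> * I (\<lambda>\<xi>. G (\<eta> \<epsilon> + tt) z \<xi> - \<gamma>) (\<rho> \<epsilon> + t) + \<theta> \<epsilon> * H (t, tt))"
    if "z \<in> Z_ad" "t \<in> A" "tt \<in> B" for z \<gamma> t tt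
  proof -
    have "f\<^sub>0 z = ereal (F z)" using df VZ that by (auto simp: F_def ereal_real')
    then show ?thesis
      using that by (simp add: Phi_def ext_indicator_def LINT I_def G_def)
  qed
  have Js: "J\<^sub>s = (\<lambda>\<xi>. G \<omega>\<^sub>s z\<^sub>s \<xi> - \<gamma>\<^sub>s)" by (simp add: J u G_def)
  \<comment> \<open>At admissible points both indicator terms vanish and \<open>f\<^sub>0\<close> is
    finite since \<open>Z_ad \<subseteq> V\<close>, so the inequality between extended reals is one
    between reals.\<close>
  have minimal': "F z\<^sub>s + \<gamma>\<^sub>s + \<kappa> * I J\<^sub>s w + \<theta> \<epsilon> * H (t\<^sub>s, tt\<^sub>s)
      \<le> F z + \<gamma> + \<kappa> * I (\<lambda>\<xi>. G (\<eta> \<epsilon> + tt) z \<xi> - \<gamma>) (\<rho> \<epsilon> + t) + \<theta> \<epsilon> * H (t, tt)"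
    if "z \<in> Z_ad" "t \<in> A" "tt \<in> B" for z \<gamma> t tt
    using minimal that AT BTT unfolding Js w_def \<omega>
    by (metis Phi[OF zs ts tts] Phi[OF that] ereal_less_eq(3))

  \<comment> \<open>Membership comes from the domain clause of the derivative of \<open>s\<close>,
    which covers all of \<open>pts TT\<close> and hence \<open>\<omega>\<^sub>s\<close>.\<close>
  have uLp: "u\<^sub>s \<in> pts (Lp M p)"
    using dtts zs \<omega>T unfolding u has_frechet_derivative_def by blast
  have dgu: "has_frechet_derivative (Lp M p) (Lp M (ennreal q')) (pts (Lp M p))
      (\<lambda>y \<xi>. real_of_ereal (g (y \<xi>))) (Dg u\<^sub>s) u\<^sub>s"
    using dg uLp by blast
  have GL: "G \<omega>\<^sub>s z\<^sub>s \<in> pts (Lp M (ennreal q'))"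
    using bspec[OF conjunct1[OF dgu[unfolded has_frechet_derivative_def]] uLp] unfolding G_def u .
  have JN: "integrable N J\<^sub>s"
  proof -
    interpret finite_measure N by fact
    have "integrable N (G \<omega>\<^sub>s z\<^sub>s)"
      unfolding N_def by (rule Lp_finite_integrable_on_finite_measure(1)[OF less_imp_le[OF q'] GL S])
    then show ?thesis by (simp add: Js)
  qed
  note plusJ = smooth_plus_integrable[OF kernel \<delta> N JN]

  \<comment> \<open>Variation of the decision \<open>z\<close>\<close>
  have 1: "Df\<^sub>0 z\<^sub>s (z - z\<^sub>s) + \<kappa> * (LINT \<xi>|N. w \<xi> * smooth_step \<zeta> \<delta> (J\<^sub>s \<xi>) * Dg u\<^sub>s (Dzs \<omega>\<^sub>s z\<^sub>s (z - z\<^sub>s)) \<xi>) \<ge> 0"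
    if z: "z \<in> Z_ad" for z
  proof -
    have seg: "z\<^sub>s + r n *\<^sub>R (z - z\<^sub>s) \<in> Z_ad" for n
      by (intro convex_segment assms(17) zs z less_imp_le[OF r(1)] r1)
    then have segV: "z\<^sub>s + r n *\<^sub>R (z - z\<^sub>s) \<in> V" for n using VZ by blast
    have zV: "z\<^sub>s \<in> V" using zs VZ by blast
    have "(\<lambda>n. (F (z\<^sub>s + r n *\<^sub>R (z - z\<^sub>s)) - F z\<^sub>s) / r n) \<longlonglongrightarrow> Df\<^sub>0 z\<^sub>s (z - z\<^sub>s)"
      using df zV unfolding F_def
      by (intro has_frechet_derivative_real_directional[OF normed_space_type_space
            has_derivative_imp_has_frechet_derivative _ _ r]) (auto simp: type_space_def)
    \<comment> \<open>The inner map \<open>s\<close> is differentiable on \<open>V\<close> and sends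
      it into \<open>pts (Lp M p)\<close>, where \<open>g\<close> is differentiable, so the chain
      rule applies on all of \<open>V\<close>.\<close>
    moreover have "has_frechet_derivative type_space (Lp M (ennreal q')) V (\<lambda>y. G \<omega>\<^sub>s y)
        (\<lambda>h. Dg u\<^sub>s (Dzs \<omega>\<^sub>s z\<^sub>s h)) z\<^sub>s"
      unfolding G_def
    proof (rule has_frechet_derivative_compose[where f="\<lambda>y \<xi>. s (\<omega>\<^sub>s \<xi>) y" and
          g="\<lambda>y \<xi>. real_of_ereal (g (y \<xi>))" and g'="Dg u\<^sub>s",
          OF normed_space_type_space p_ns q'_ns _ zV])
      show F: "has_frechet_derivative type_space (Lp M p) V (\<lambda>y \<xi>. s (\<omega>\<^sub>s \<xi>) y) (Dzs \<omega>\<^sub>s z\<^sub>s) z\<^sub>s"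
        using dzs \<omega>T zV by blast
      show "has_frechet_derivative (Lp M p) (Lp M (ennreal q')) (pts (Lp M p))
          (\<lambda>y \<xi>. real_of_ereal (g (y \<xi>))) (Dg u\<^sub>s) (\<lambda>\<xi>. s (\<omega>\<^sub>s \<xi>) z\<^sub>s)"
        using dgu unfolding u .
      show "(\<lambda>\<xi>. s (\<omega>\<^sub>s \<xi>) y) \<in> pts (Lp M p)" if "y \<in> V" for y
        using F that unfolding has_frechet_derivative_def by blast
    qed
    from smooth_plus_integral_frechet_directional[OF kernel \<delta> normed_space_type_space less_imp_le[OF q'] this zV _
        r segV S wm K, of \<gamma>\<^sub>s]
    have "(\<lambda>n. (I (\<lambda>\<xi>. G \<omega>\<^sub>s (z\<^sub>s + r n *\<^sub>R (z - z\<^sub>s)) \<xi> - \<gamma>\<^sub>s) w - I J\<^sub>s w) / r n)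
        \<longlonglongrightarrow> (LINT \<xi>|N. w \<xi> * smooth_step \<zeta> \<delta> (J\<^sub>s \<xi>) * Dg u\<^sub>s (Dzs \<omega>\<^sub>s z\<^sub>s (z - z\<^sub>s)) \<xi>)"
      by (simp add: I_def Js N_def type_space_def)
    ultimately have "(\<lambda>n. (F (z\<^sub>s + r n *\<^sub>R (z - z\<^sub>s)) - F z\<^sub>s) / r n
          + \<kappa> * ((I (\<lambda>\<xi>. G \<omega>\<^sub>s (z\<^sub>s + r n *\<^sub>R (z - z\<^sub>s)) \<xi> - \<gamma>\<^sub>s) w - I J\<^sub>s w) / r n))
        \<longlonglongrightarrow> Df\<^sub>0 z\<^sub>s (z - z\<^sub>s) + \<kappa> * (LINT \<xi>|N. w \<xi> * smooth_step \<zeta> \<delta> (J\<^sub>s \<xi>) * Dg u\<^sub>s (Dzs \<omega>\<^sub>s z\<^sub>s (z - z\<^sub>s)) \<xi>)"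
      by (intro tendsto_intros)
    then show ?thesis
    proof (rule limit_nonneg)
      fix n
      \<comment> \<open>Only \<open>z\<close> has moved, so \<open>\<gamma>\<^sub>s\<close> and the
        penalty cancel in the inequality.\<close>
      have "0 \<le> (F (z\<^sub>s + r n *\<^sub>R (z - z\<^sub>s)) - F z\<^sub>s)
          + \<kappa> * (I (\<lambda>\<xi>. G \<omega>\<^sub>s (z\<^sub>s + r n *\<^sub>R (z - z\<^sub>s)) \<xi> - \<gamma>\<^sub>s) w - I J\<^sub>s w)"
        using minimal'[OF seg ts tts, of n \<gamma>\<^sub>s] by (simp add: \<omega> w_def algebra_simps)
      then have "0 \<le> ((F (z\<^sub>s + r n *\<^sub>R (z - z\<^sub>s)) - F z\<^sub>s)
          + \<kappa> * (I (\<lambda>\<xi>. G \<omega>\<^sub>s (z\<^sub>s + r n *\<^sub>R (z - z\<^sub>s)) \<xi> - \<gamma>\<^sub>s) w - I J\<^sub>s w)) / r n"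
        using r(1)[of n] by simp
      then show "0 \<le> (F (z\<^sub>s + r n *\<^sub>R (z - z\<^sub>s)) - F z\<^sub>s) / r n
          + \<kappa> * ((I (\<lambda>\<xi>. G \<omega>\<^sub>s (z\<^sub>s + r n *\<^sub>R (z - z\<^sub>s)) \<xi> - \<gamma>\<^sub>s) w - I J\<^sub>s w) / r n)"
        by (simp add: add_divide_distrib)
    qed
  qed

  \<comment> \<open>Variation of the threshold \<gamma>\<close>
  have 2: "(LINT \<xi>|N. w \<xi> * smooth_step \<zeta> \<delta> (J\<^sub>s \<xi>)) = 1 / \<kappa>"
  proof -
    \<comment> \<open>Moving \<gamma> by \<open>r n * c\<close> shifts \<open>J\<^sub>s\<close> by
      the constant \<open>- r n * c\<close>, so the linearization is exact. Since \<gamma> is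
      unconstrained, \<open>c = 1\<close> and \<open>c = -1\<close> are both allowed, and the two
      inequalities give the equation.\<close>
    have "0 \<le> c + \<kappa> * (LINT \<xi>|N. w \<xi> * smooth_step \<zeta> \<delta> (J\<^sub>s \<xi>) * - c)" for c
    proof -
      interpret finite_measure N by fact
      have "(\<lambda>n. (I (\<lambda>\<xi>. J\<^sub>s \<xi> - r n * c) w - I J\<^sub>s w) / r n)
          \<longlonglongrightarrow> (LINT \<xi>|N. w \<xi> * smooth_step \<zeta> \<delta> (J\<^sub>s \<xi>) * - c)"
        unfolding I_def
      proof (rule smooth_plus_integral_directional[OF kernel \<delta> N JN _ _ _ _ r])
        show "w \<in> borel_measurable N" unfolding N_def using wm by (rule measurable_restrict_space1)
        show "AE \<xi> in N. \<bar>w \<xi>\<bar> \<le> K"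
          unfolding N_def using K S(1) by (subst AE_restrict_space_iff) (auto elim: eventually_mono)
      qed (use JN in auto)
      then have "(\<lambda>n. c + \<kappa> * ((I (\<lambda>\<xi>. J\<^sub>s \<xi> - r n * c) w - I J\<^sub>s w) / r n))
          \<longlonglongrightarrow> c + \<kappa> * (LINT \<xi>|N. w \<xi> * smooth_step \<zeta> \<delta> (J\<^sub>s \<xi>) * - c)"
        by (intro tendsto_intros)
      then show ?thesis
      proof (rule limit_nonneg)
        fix n
        have "0 \<le> r n * c + \<kappa> * (I (\<lambda>\<xi>. J\<^sub>s \<xi> - r n * c) w - I J\<^sub>s w)"
          using minimal'[OF zs ts tts, of "\<gamma>\<^sub>s + r n * c"] by (simp add: \<omega> w_def Js diff_diff_eq algebra_simps)
        then have "0 \<le> (r n * c + \<kappa> * (I (\<lambda>\<xi>. J\<^sub>s \<xi> - r n * c) w - I J\<^sub>s w)) / r n"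
          using r(1)[of n] by simp
        then show "0 \<le> c + \<kappa> * ((I (\<lambda>\<xi>. J\<^sub>s \<xi> - r n * c) w - I J\<^sub>s w) / r n)"
          using r(1)[of n] by (simp add: add_divide_distrib)
      qed
    qed
    from this[of 1] this[of "-1"] \<kappa> show ?thesis by (simp add: field_simps)
  qed

  \<comment> \<open>Variation of the density perturbation\<close>
  have 3: "\<theta> \<epsilon> * DtH (t\<^sub>s, tt\<^sub>s) (t - t\<^sub>s) + \<kappa> * (LINT \<xi>|N. smooth_plus \<zeta> \<delta> (J\<^sub>s \<xi>) * (t \<xi> - t\<^sub>s \<xi>)) \<ge> 0"
    if t: "t \<in> A" for t
  proof -
    let ?tn = "\<lambda>n. t\<^sub>s + r n *\<^sub>R (t - t\<^sub>s)"
    have seg: "?tn n \<in> A" for n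
      by (intro convex_segment A_convex ts t less_imp_le[OF r(1)] r1)
    \<comment> \<open>The integral is affine in its density, so its difference quotient does not
      depend on \<open>n\<close> and only \<open>H\<close> needs a limit.\<close>
    have I_lin: "I J\<^sub>s (\<rho> \<epsilon> + ?tn n) = I J\<^sub>s w + r n * (LINT \<xi>|N. smooth_plus \<zeta> \<delta> (J\<^sub>s \<xi>) * (t \<xi> - t\<^sub>s \<xi>))" for n
    proof -
      have i: "integrable N (\<lambda>\<xi>. smooth_plus \<zeta> \<delta> (J\<^sub>s \<xi>) * w \<xi>)"
        "integrable N (\<lambda>\<xi>. smooth_plus \<zeta> \<delta> (J\<^sub>s \<xi>) * (\<rho> \<epsilon> + t) \<xi>)"
        by (intro dens_N plusJ w_dens A_dens t)+
      \<comment> \<open>\<open>t - t\<^sub>s\<close> is the difference of the densities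
        \<open>\<rho> \<epsilon> + t\<close> and \<open>w\<close>, both essentially bounded.\<close>
      have d: "integrable N (\<lambda>\<xi>. smooth_plus \<zeta> \<delta> (J\<^sub>s \<xi>) * (t \<xi> - t\<^sub>s \<xi>))"
        using Bochner_Integration.integrable_diff[OF i(2,1)] by (simp add: w_def algebra_simps)
      have "I J\<^sub>s (\<rho> \<epsilon> + ?tn n)
          = (LINT \<xi>|N. smooth_plus \<zeta> \<delta> (J\<^sub>s \<xi>) * w \<xi> + r n * (smooth_plus \<zeta> \<delta> (J\<^sub>s \<xi>) * (t \<xi> - t\<^sub>s \<xi>)))"
        unfolding I_def
        by (intro Bochner_Integration.integral_cong) (auto simp: w_def scaleR_fun_def algebra_simps)
      also have "\<dots> = I J\<^sub>s w + r n * (LINT \<xi>|N. smooth_plus \<zeta> \<delta> (J\<^sub>s \<xi>) * (t \<xi> - t\<^sub>s \<xi>))"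
        unfolding I_def using i(1) d by simp
      finally show ?thesis .
    qed
    have "(\<lambda>n. (H (?tn n, tt\<^sub>s) - H (t\<^sub>s, tt\<^sub>s)) / r n) \<longlonglongrightarrow> DtH (t\<^sub>s, tt\<^sub>s) (t - t\<^sub>s)"
      by (rule has_frechet_derivative_real_directional[OF T_ns
            bspec[OF bspec[OF dH1 AT[OF ts]] BTT[OF tts]] AT[OF ts] pts_diff[OF T_ns AT[OF t] AT[OF ts]] r AT[OF seg]])
    then have "(\<lambda>n. \<theta> \<epsilon> * ((H (?tn n, tt\<^sub>s) - H (t\<^sub>s, tt\<^sub>s)) / r n)
          + \<kappa> * (LINT \<xi>|N. smooth_plus \<zeta> \<delta> (J\<^sub>s \<xi>) * (t \<xi> - t\<^sub>s \<xi>)))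
        \<longlonglongrightarrow> \<theta> \<epsilon> * DtH (t\<^sub>s, tt\<^sub>s) (t - t\<^sub>s) + \<kappa> * (LINT \<xi>|N. smooth_plus \<zeta> \<delta> (J\<^sub>s \<xi>) * (t \<xi> - t\<^sub>s \<xi>))"
      by (intro tendsto_intros)
    then show ?thesis
    proof (rule limit_nonneg)
      fix n
      let ?D = "LINT \<xi>|N. smooth_plus \<zeta> \<delta> (J\<^sub>s \<xi>) * (t \<xi> - t\<^sub>s \<xi>)"
      have "\<kappa> * I J\<^sub>s w + \<theta> \<epsilon> * H (t\<^sub>s, tt\<^sub>s) \<le> \<kappa> * (I J\<^sub>s w + r n * ?D) + \<theta> \<epsilon> * H (?tn n, tt\<^sub>s)"
        using minimal'[OF zs seg tts, of \<gamma>\<^sub>s n] unfolding \<omega>[symmetric] Js[symmetric] I_lin by linarith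
      then have "0 \<le> (\<theta> \<epsilon> * (H (?tn n, tt\<^sub>s) - H (t\<^sub>s, tt\<^sub>s)) + r n * (\<kappa> * ?D)) / r n"
        using r(1)[of n] by (intro divide_nonneg_pos) (auto simp: right_diff_distrib distrib_left mult.left_commute)
      then show "0 \<le> \<theta> \<epsilon> * ((H (?tn n, tt\<^sub>s) - H (t\<^sub>s, tt\<^sub>s)) / r n) + \<kappa> * ?D"
        using r(1)[of n] by (simp add: add_divide_distrib)
    qed
  qed

  \<comment> \<open>Variation of the vector-valued perturbation\<close>
  have 4: "\<theta> \<epsilon> * DttH (t\<^sub>s, tt\<^sub>s) (tt - tt\<^sub>s)
      + \<kappa> * (LINT \<xi>|N. w \<xi> * smooth_step \<zeta> \<delta> (J\<^sub>s \<xi>) * Dg u\<^sub>s (Dtts \<omega>\<^sub>s z\<^sub>s (tt - tt\<^sub>s)) \<xi>) \<ge> 0"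
    if tt: "tt \<in> B" for tt
  proof -
    let ?tn = "\<lambda>n. tt\<^sub>s + r n *\<^sub>R (tt - tt\<^sub>s)"
    have seg: "?tn n \<in> B" for n
      by (intro convex_segment B_convex tts tt less_imp_le[OF r(1)] r1)
    have h: "tt - tt\<^sub>s \<in> pts TT" using BTT[OF tt] BTT[OF tts] by (rule pts_diff[OF TT_ns])
    have seg\<omega>: "\<omega>\<^sub>s + r n *\<^sub>R (tt - tt\<^sub>s) \<in> pts TT" for n
      by (intro pts_add[OF TT_ns] pts_scaleR[OF TT_ns] \<omega>T h)
    \<comment> \<open>One increment moves \<open>tt\<^sub>s\<close> in the penalty and
      \<open>\<omega>\<^sub>s\<close> in the integrand: the two derivatives share the direction but
      have different base points.\<close>
    have eq\<omega>: "\<eta> \<epsilon> + ?tn n = \<omega>\<^sub>s + r n *\<^sub>R (tt - tt\<^sub>s)" for n by (simp only: \<omega> add.assoc)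
    have "(\<lambda>n. (H (t\<^sub>s, ?tn n) - H (t\<^sub>s, tt\<^sub>s)) / r n) \<longlonglongrightarrow> DttH (t\<^sub>s, tt\<^sub>s) (tt - tt\<^sub>s)"
      by (rule has_frechet_derivative_real_directional[OF TT_ns
            bspec[OF bspec[OF dH2 AT[OF ts]] BTT[OF tts]] BTT[OF tts] h r BTT[OF seg]])
    moreover have "has_frechet_derivative TT (Lp M (ennreal q')) (pts TT) (\<lambda>y. G y z\<^sub>s)
        (\<lambda>h. Dg u\<^sub>s (Dtts \<omega>\<^sub>s z\<^sub>s h)) \<omega>\<^sub>s"
      unfolding G_def
    proof (rule has_frechet_derivative_compose[where f="\<lambda>y \<xi>. s (y \<xi>) z\<^sub>s" and
          g="\<lambda>y \<xi>. real_of_ereal (g (y \<xi>))" and g'="Dg u\<^sub>s",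
          OF TT_ns p_ns q'_ns _ \<omega>T])
      show F: "has_frechet_derivative TT (Lp M p) (pts TT) (\<lambda>y \<xi>. s (y \<xi>) z\<^sub>s) (Dtts \<omega>\<^sub>s z\<^sub>s) \<omega>\<^sub>s"
        using dtts \<omega>T zs by blast
      show "has_frechet_derivative (Lp M p) (Lp M (ennreal q')) (pts (Lp M p))
          (\<lambda>y \<xi>. real_of_ereal (g (y \<xi>))) (Dg u\<^sub>s) (\<lambda>\<xi>. s (\<omega>\<^sub>s \<xi>) z\<^sub>s)"
        using dgu unfolding u .
      show "(\<lambda>\<xi>. s (y \<xi>) z\<^sub>s) \<in> pts (Lp M p)" if "y \<in> pts TT" for y
        using F that unfolding has_frechet_derivative_def by blast
    qed
    from smooth_plus_integral_frechet_directional[OF kernel \<delta> TT_ns less_imp_le[OF q'] this \<omega>T h r seg\<omega> S wm K, of \<gamma>\<^sub>s]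
    have "(\<lambda>n. (I (\<lambda>\<xi>. G (\<omega>\<^sub>s + r n *\<^sub>R (tt - tt\<^sub>s)) z\<^sub>s \<xi> - \<gamma>\<^sub>s) w - I J\<^sub>s w) / r n)
        \<longlonglongrightarrow> (LINT \<xi>|N. w \<xi> * smooth_step \<zeta> \<delta> (J\<^sub>s \<xi>) * Dg u\<^sub>s (Dtts \<omega>\<^sub>s z\<^sub>s (tt - tt\<^sub>s)) \<xi>)"
      unfolding I_def Js N_def .
    ultimately have "(\<lambda>n. \<theta> \<epsilon> * ((H (t\<^sub>s, ?tn n) - H (t\<^sub>s, tt\<^sub>s)) / r n)
          + \<kappa> * ((I (\<lambda>\<xi>. G (\<omega>\<^sub>s + r n *\<^sub>R (tt - tt\<^sub>s)) z\<^sub>s \<xi> - \<gamma>\<^sub>s) w - I J\<^sub>s w) / r n))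
        \<longlonglongrightarrow> \<theta> \<epsilon> * DttH (t\<^sub>s, tt\<^sub>s) (tt - tt\<^sub>s)
          + \<kappa> * (LINT \<xi>|N. w \<xi> * smooth_step \<zeta> \<delta> (J\<^sub>s \<xi>) * Dg u\<^sub>s (Dtts \<omega>\<^sub>s z\<^sub>s (tt - tt\<^sub>s)) \<xi>)"
      by (intro tendsto_intros)
    then show ?thesis
    proof (rule limit_nonneg)
      fix n
      let ?I = "I (\<lambda>\<xi>. G (\<omega>\<^sub>s + r n *\<^sub>R (tt - tt\<^sub>s)) z\<^sub>s \<xi> - \<gamma>\<^sub>s) w"
      have "\<kappa> * I J\<^sub>s w + \<theta> \<epsilon> * H (t\<^sub>s, tt\<^sub>s) \<le> \<kappa> * ?I + \<theta> \<epsilon> * H (t\<^sub>s, ?tn n)"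
        using minimal'[OF zs ts seg, of \<gamma>\<^sub>s n] unfolding eq\<omega> w_def[symmetric] by linarith
      then have "0 \<le> (\<theta> \<epsilon> * (H (t\<^sub>s, ?tn n) - H (t\<^sub>s, tt\<^sub>s)) + \<kappa> * (?I - I J\<^sub>s w)) / r n"
        using r(1)[of n] by (intro divide_nonneg_pos) (auto simp: right_diff_distrib)
      then show "0 \<le> \<theta> \<epsilon> * ((H (t\<^sub>s, ?tn n) - H (t\<^sub>s, tt\<^sub>s)) / r n) + \<kappa> * ((?I - I J\<^sub>s w) / r n)"
        by (simp add: add_divide_distrib)
    qed
  qed

  show ?thesis
    using 1 2 3 4 unfolding LINT w_def plus_fun_apply by blast
qed

end
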